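(* Let $G$ be a finite, simple, connected graph with Laplacian $L=D-A$, and let $\phi_2$ be an eigenvector of $L$ associated with its second smallest eigenvalue $\lambda_2(G)$. Suppose $G$ contains a longest path $P$ of length $\operatorname{diam}(G)$, with vertices numbered consecutively $1,2,\dots$ from one endpoint, such that $G$ consists of $P$ together with graphs $G_{k,i}$ attached to the vertices $k$ of $P$, where the attached graphs are isolated: any path from any vertex in $G_{k,i}$ to a vertex outside $G_{k,i}$ goes through the vertex $k$. Assume that each graph $G_{k,i}$ attached to vertex $k$ satisfies \begin{enumerate} \item $|G_{k,i}| \leq \frac{\operatorname{diam}(G)}{32}$, and \item $\operatorname{hit}(G_{k,i}) \leq \frac{1}{50}\min\{k, \operatorname{diam}(G)-k\}^2$. \end{enumerate} Then $\phi_2$ assumes its extrema (maximum and minimum) at the endpoints of the path $P$.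
   Context: $D$ is the diagonal degree matrix and $A$ the adjacency matrix of $G$; the eigenvalues of $L$ are $0=\lambda_1\le\lambda_2\le\dots$. $|G_{k,i}|$ is the number of vertices of the attached graph $G_{k,i}$. For a vertex $v\in G_{k,i}$, $\operatorname{hit}(v)$ denotes the expected number of steps that a simple random walk on $G$ started at $v$ (jumping at each step to a uniformly random neighbor) needs until it first hits the path $P$, and $\operatorname{hit}(G_{k,i})=\max_{v\in G_{k,i}}\operatorname{hit}(v)$. *)

theory Defs
  imports "HOL-Analysis.Analysis" "HOL-Probability.Probability"
begin

text \<open>
  A finite simple graph is given by its adjacency relation on a finite type of vertices.
\<close>

definition simple_graph :: "('v::finite \<Rightarrow> 'v \<Rightarrow> bool) \<Rightarrow> bool" where
  "simple_graph E \<longleftrightarrow> symp E \<and> irreflp E"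

definition neighbors :: "('v::finite \<Rightarrow> 'v \<Rightarrow> bool) \<Rightarrow> 'v \<Rightarrow> 'v set" where
  "neighbors E v = {w. E v w}"

definition is_walk :: "('v::finite \<Rightarrow> 'v \<Rightarrow> bool) \<Rightarrow> 'v list \<Rightarrow> bool" where
  "is_walk E xs \<longleftrightarrow> xs \<noteq> [] \<and> successively E xs"

definition is_path :: "('v::finite \<Rightarrow> 'v \<Rightarrow> bool) \<Rightarrow> 'v list \<Rightarrow> bool" where
  "is_path E xs \<longleftrightarrow> is_walk E xs \<and> distinct xs"

definition walk_length :: "'v list \<Rightarrow> nat" where
  "walk_length xs = length xs - 1"

definition connected_graph :: "('v::finite \<Rightarrow> 'v \<Rightarrow> bool) \<Rightarrow> bool" where
  "connected_graph E \<longleftrightarrow> (\<forall>u v. \<exists>xs. is_walk E xs \<and> hd xs = u \<and> last xs = v)"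

definition graph_dist :: "('v::finite \<Rightarrow> 'v \<Rightarrow> bool) \<Rightarrow> 'v \<Rightarrow> 'v \<Rightarrow> nat" where
  "graph_dist E u v = (LEAST n. \<exists>xs. is_walk E xs \<and> hd xs = u \<and> last xs = v \<and> walk_length xs = n)"

definition graph_diam :: "('v::finite \<Rightarrow> 'v \<Rightarrow> bool) \<Rightarrow> nat" where
  "graph_diam E = Max {graph_dist E u v | u v. True}"

text \<open>
  ``Longest path of length diam'' is understood in the graph metric: a shortest path between two
  vertices at maximal distance. A path that is longest among all simple paths, has no chords and
  whose length is the diameter is a special case.
\<close>

definition diametral_path :: "('v::finite \<Rightarrow> 'v \<Rightarrow> bool) \<Rightarrow> 'v list \<Rightarrow> bool" where
  "diametral_path E P \<longleftrightarrow>
     is_path E P \<and> walk_length P = graph_diam E \<and> graph_dist E (hd P) (last P) = graph_diam E"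

text \<open>The vertices of a path are numbered from 1.\<close>

definition path_vertex :: "'v list \<Rightarrow> nat \<Rightarrow> 'v" where
  "path_vertex P k = P ! (k - 1)"

text \<open>
  The graphs attached to the \<open>k\<close>-th vertex of \<open>P\<close> are the subgraphs induced on the vertex sets
  \<open>H k i\<close> with \<open>1 \<le> i \<le> m k\<close>, where \<open>m k = 0\<close> is allowed. The vertex \<open>k\<close> itself is not counted as
  a vertex of the attached graphs.
\<close>

definition attachment_indices :: "'v list \<Rightarrow> (nat \<Rightarrow> nat) \<Rightarrow> (nat \<times> nat) set" where
  "attachment_indices P m = (SIGMA k:{1..length P}. {1..m k})"

definition path_with_attachments ::
  "('v::finite \<Rightarrow> 'v \<Rightarrow> bool) \<Rightarrow> 'v list \<Rightarrow> (nat \<Rightarrow> nat) \<Rightarrow> (nat \<Rightarrow> nat \<Rightarrow> 'v set) \<Rightarrow> bool" where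
  "path_with_attachments E P m H \<longleftrightarrow>
     (\<forall>(k, i) \<in> attachment_indices P m. H k i \<noteq> {} \<and> H k i \<inter> set P = {}) \<and>
     disjoint_family_on (\<lambda>(k, i). H k i) (attachment_indices P m) \<and>
     UNIV = set P \<union> (\<Union>(k, i) \<in> attachment_indices P m. H k i) \<and>
     (\<forall>u v. E u v \<longrightarrow>
        (\<exists>k. 1 \<le> k \<and> k < length P \<and> {u, v} = {path_vertex P k, path_vertex P (k + 1)}) \<or>
        (\<exists>(k, i) \<in> attachment_indices P m. {u, v} \<subseteq> insert (path_vertex P k) (H k i)))"

definition isolated_attachments ::
  "('v::finite \<Rightarrow> 'v \<Rightarrow> bool) \<Rightarrow> 'v list \<Rightarrow> (nat \<Rightarrow> nat) \<Rightarrow> (nat \<Rightarrow> nat \<Rightarrow> 'v set) \<Rightarrow> bool" where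
  "isolated_attachments E P m H \<longleftrightarrow>
     (\<forall>(k, i) \<in> attachment_indices P m. \<forall>xs.
        is_path E xs \<and> hd xs \<in> H k i \<and> last xs \<notin> H k i \<longrightarrow> path_vertex P k \<in> set xs)"

definition adjacency_matrix :: "('v::finite \<Rightarrow> 'v \<Rightarrow> bool) \<Rightarrow> real^'v^'v" where
  "adjacency_matrix E = (\<chi> u v. if E u v then 1 else 0)"

definition degree_matrix :: "('v::finite \<Rightarrow> 'v \<Rightarrow> bool) \<Rightarrow> real^'v^'v" where
  "degree_matrix E = (\<chi> u v. if u = v then real (card (neighbors E u)) else 0)"

definition laplacian :: "('v::finite \<Rightarrow> 'v \<Rightarrow> bool) \<Rightarrow> real^'v^'v" where
  "laplacian E = degree_matrix E - adjacency_matrix E"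

definition eigenspace :: "real^'n^'n \<Rightarrow> real \<Rightarrow> (real^'n) set" where
  "eigenspace A \<mu> = {x. A *v x = \<mu> *\<^sub>R x}"

definition is_eigenvector :: "real^'n^'n \<Rightarrow> real \<Rightarrow> real^'n \<Rightarrow> bool" where
  "is_eigenvector A \<mu> x \<longleftrightarrow> x \<noteq> 0 \<and> x \<in> eigenspace A \<mu>"

definition eigenvalues :: "real^'n^'n \<Rightarrow> real set" where
  "eigenvalues A = {\<mu>. \<exists>x. is_eigenvector A \<mu> x}"

text \<open>
  The eigenvalues of a symmetric matrix in increasing order, each repeated according to the
  dimension of its eigenspace; entry \<open>0\<close> of the list is \<open>\<lambda>\<^sub>1\<close>.
\<close>

definition eigenvalue_list :: "real^'n^'n \<Rightarrow> real list" where
  "eigenvalue_list A =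
     sorted_list_of_multiset (\<Sum>\<mu>\<in>eigenvalues A. replicate_mset (dim (eigenspace A \<mu>)) \<mu>)"

definition lambda2 :: "('v::finite \<Rightarrow> 'v \<Rightarrow> bool) \<Rightarrow> real" where
  "lambda2 E = eigenvalue_list (laplacian E) ! 1"

lemma finite_eigenvalues_symmetric:
  fixes A :: "real^'n^'n"
  assumes "transpose A = A"
  shows "finite (eigenvalues A)"
proof -
  define x where "x \<mu> = (SOME x. is_eigenvector A \<mu> x)" for \<mu>
  have x: "is_eigenvector A \<mu> (x \<mu>)" if "\<mu> \<in> eigenvalues A" for \<mu>
    using that unfolding x_def eigenvalues_def by (auto intro: someI_ex)
  have orth: "x \<mu> \<bullet> x \<nu> = 0" if "\<mu> \<in> eigenvalues A" "\<nu> \<in> eigenvalues A" "\<mu> \<noteq> \<nu>" for \<mu> \<nu>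
  proof -
    have "\<mu> * (x \<mu> \<bullet> x \<nu>) = (A *v x \<mu>) \<bullet> x \<nu>"
      using x[OF that(1)] by (simp add: is_eigenvector_def eigenspace_def)
    also have "\<dots> = x \<mu> \<bullet> (A *v x \<nu>)"
      using assms by (metis dot_lmul_matrix transpose_matrix_vector)
    also have "\<dots> = \<nu> * (x \<mu> \<bullet> x \<nu>)"
      using x[OF that(2)] by (simp add: is_eigenvector_def eigenspace_def)
    finally show ?thesis using that(3) by simp
  qed
  have nz: "x \<mu> \<noteq> 0" if "\<mu> \<in> eigenvalues A" for \<mu>
    using x[OF that] by (simp add: is_eigenvector_def)
  have "inj_on x (eigenvalues A)"
    by (rule inj_onI) (metis orth nz inner_eq_zero_iff)
  moreover have "independent (x ` eigenvalues A)"
    using nz orth by (intro pairwise_orthogonal_independent)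
      (auto simp: pairwise_def orthogonal_def)
  ultimately show ?thesis
    using finite_imageD independent_imp_finite by blast
qed

text \<open>
  The simple random walk is driven by an i.i.d. sequence of random maps: at time \<open>n\<close> every vertex
  draws a uniformly random neighbor, and the walk moves to the one drawn by its current position.
  The lemma \<open>emeasure_random_walk_prefix\<close> shows that this yields the law of the simple random walk.
\<close>

definition step_maps :: "('v::finite \<Rightarrow> 'v \<Rightarrow> bool) \<Rightarrow> ('v \<Rightarrow> 'v) pmf" where
  "step_maps E = Pi_pmf UNIV undefined (\<lambda>v. pmf_of_set (neighbors E v))"

definition walk_space :: "('v::finite \<Rightarrow> 'v \<Rightarrow> bool) \<Rightarrow> ('v \<Rightarrow> 'v) stream measure" where
  "walk_space E = stream_space (measure_pmf (step_maps E))"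

primrec random_walk :: "'v \<Rightarrow> ('v \<Rightarrow> 'v) stream \<Rightarrow> nat \<Rightarrow> 'v" where
  "random_walk v \<omega> 0 = v"
| "random_walk v \<omega> (Suc n) = (\<omega> !! n) (random_walk v \<omega> n)"

definition hitting_time :: "'v set \<Rightarrow> 'v \<Rightarrow> ('v \<Rightarrow> 'v) stream \<Rightarrow> enat" where
  "hitting_time S v \<omega> = Inf {enat n | n. random_walk v \<omega> n \<in> S}"

definition hit :: "('v::finite \<Rightarrow> 'v \<Rightarrow> bool) \<Rightarrow> 'v set \<Rightarrow> 'v \<Rightarrow> ennreal" where
  "hit E S v = (\<integral>\<^sup>+ \<omega>. ennreal_of_enat (hitting_time S v \<omega>) \<partial>walk_space E)"

definition hit_max :: "('v::finite \<Rightarrow> 'v \<Rightarrow> bool) \<Rightarrow> 'v set \<Rightarrow> 'v set \<Rightarrow> ennreal" where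
  "hit_max E S K = Max (hit E S ` K)"

lemma random_walk_Stream: "random_walk v (f ## \<omega>) (Suc n) = random_walk (f v) \<omega> n"
  by (induction n) auto

lemma measurable_random_walk [measurable]:
  fixes E :: "'v::finite \<Rightarrow> 'v \<Rightarrow> bool"
  shows "(\<lambda>\<omega>. random_walk v \<omega> n) \<in> walk_space E \<rightarrow>\<^sub>M count_space UNIV"
proof (induction n)
  case (Suc n)
  have snth: "(\<lambda>\<omega>. \<omega> !! n) \<in> walk_space E \<rightarrow>\<^sub>M count_space UNIV"
    using measurable_snth[of n "measure_pmf (step_maps E)"]
    unfolding walk_space_def by (simp cong: measurable_cong_sets)
  have "(\<lambda>\<omega>. (\<lambda>u \<omega>. (\<omega> !! n) u) (random_walk v \<omega> n) \<omega>) \<in> walk_space E \<rightarrow>\<^sub>M count_space UNIV"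
    by (rule measurable_compose_countable[OF measurable_compose[OF snth] Suc]) auto
  then show ?case by simp
qed simp

lemma emeasure_random_walk_prefix:
  fixes E :: "'v::finite \<Rightarrow> 'v \<Rightarrow> bool"
  assumes "\<And>v. neighbors E v \<noteq> {}"
  shows "emeasure (walk_space E) {\<omega> \<in> space (walk_space E). \<forall>j\<le>n. random_walk v \<omega> j = x j} =
    (if x 0 = v then \<Prod>j<n. if E (x j) (x (Suc j)) then ennreal (1 / card (neighbors E (x j))) else 0
     else 0)"
proof (induction n arbitrary: v x)
  case 0
  interpret prob_space "walk_space E"
    unfolding walk_space_def by (rule prob_space.prob_space_stream_space[OF prob_space_measure_pmf])
  show ?case by (simp add: emeasure_space_1)
next
  case (Suc n)
  let ?M = "measure_pmf (step_maps E)"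
  define y where "y = (\<lambda>j. x (Suc j))"
  define C where "C = (\<Prod>j<n. if E (y j) (y (Suc j)) then ennreal (1 / card (neighbors E (y j))) else 0)"
  have m: "{\<omega> \<in> space (walk_space E). \<forall>j\<le>Suc n. random_walk v \<omega> j = x j} \<in> sets (walk_space E)"
    by measurable
  have split: "(\<forall>j\<le>Suc n. Q j) \<longleftrightarrow> Q 0 \<and> (\<forall>j\<le>n. Q (Suc j))" for Q
    by (metis Suc_le_mono le0 not0_implies_Suc)
  have step: "(\<forall>j\<le>Suc n. random_walk v (f ## \<omega>) j = x j) \<longleftrightarrow>
      v = x 0 \<and> (\<forall>j\<le>n. random_walk (f v) \<omega> j = y j)" for f \<omega>
    unfolding y_def split random_walk_Stream by simp
  have "emeasure (walk_space E) {\<omega> \<in> space (walk_space E). \<forall>j\<le>Suc n. random_walk v \<omega> j = x j} =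
      (\<integral>\<^sup>+ f. emeasure (walk_space E) {\<omega> \<in> space (walk_space E).
         f ## \<omega> \<in> {\<omega> \<in> space (walk_space E). \<forall>j\<le>Suc n. random_walk v \<omega> j = x j}} \<partial>?M)"
    using m unfolding walk_space_def by (rule prob_space.emeasure_stream_space[OF prob_space_measure_pmf])
  also have "\<dots> = (\<integral>\<^sup>+ f. (if v = x 0 then emeasure (walk_space E)
      {\<omega> \<in> space (walk_space E). \<forall>j\<le>n. random_walk (f v) \<omega> j = y j} else 0) \<partial>?M)"
    by (intro nn_integral_cong) (auto simp: step walk_space_def space_stream_space)
  also have "\<dots> = (\<integral>\<^sup>+ f. (if v = x 0 then C else 0) * indicator {x 1} (f v) \<partial>?M)"
    unfolding Suc.IH C_def[symmetric] by (intro nn_integral_cong) (auto simp: y_def)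
  also have "\<dots> = (if v = x 0 then C else 0) * (\<integral>\<^sup>+ f. indicator {x 1} (f v) \<partial>?M)"
    by (rule nn_integral_cmult) simp
  also have "(\<integral>\<^sup>+ f. indicator {x 1} (f v) \<partial>?M) =
      (\<integral>\<^sup>+ u. indicator {x 1} u \<partial>measure_pmf (map_pmf (\<lambda>f. f v) (step_maps E)))"
    by simp
  also have "map_pmf (\<lambda>f. f v) (step_maps E) = pmf_of_set (neighbors E v)"
    unfolding step_maps_def by (rule Pi_pmf_component[of UNIV v, simplified])
  also have "(\<integral>\<^sup>+ u. indicator {x 1} u \<partial>measure_pmf (pmf_of_set (neighbors E v))) =
      (if E v (x 1) then ennreal (1 / card (neighbors E v)) else 0)"
    using assms by (simp add: emeasure_pmf_single pmf_of_set neighbors_def)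
  also have "(if v = x 0 then C else 0) * \<dots> = (if x 0 = v then \<Prod>j<Suc n.
      if E (x j) (x (Suc j)) then ennreal (1 / card (neighbors E (x j))) else 0 else 0)"
    unfolding C_def y_def by (auto simp: prod.lessThan_Suc_shift mult.commute simp del: prod.lessThan_Suc)
  finally show ?case .
qed

end

theory Submission
  imports Defs
begin

text \<open>
  Testing the Rayleigh quotient with the position along the path gives \<open>\<lambda>\<^sub>2 \<le> 12 / diam\<^sup>2\<close>. On an
  attached graph, the maximum principle with the hitting time as barrier bounds the deviation of
  \<open>\<phi>\<^sub>2\<close> from its value \<open>x\<close> at the attaching vertex by \<open>2 \<lambda>\<^sub>2 hit \<bar>x\<bar>\<close>, so \<open>\<phi>\<^sub>2\<close> has the sign of \<open>x\<close>
  there. By a nodal domain argument \<open>\<phi>\<^sub>2\<close> changes its sign only once along the path. Since the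
  difference of \<open>\<phi>\<^sub>2\<close> across a path edge is \<open>\<lambda>\<^sub>2\<close> times the sum of \<open>\<phi>\<^sub>2\<close> over one side of the edge,
  \<open>\<phi>\<^sub>2\<close> is monotone along the path, and it changes between an endpoint and the \<open>k\<close>-th vertex from it
  by at least \<open>\<lambda>\<^sub>2 k (k - 1) / 2\<close> times the value at the latter, which exceeds the deviation on the
  attached graphs.
\<close>

section \<open>The second Laplacian eigenvalue\<close>

lemma symmetric_matrix_inner:
  fixes A :: "real^'n^'n"
  assumes "transpose A = A"
  shows "(A *v x) \<bullet> y = x \<bullet> (A *v y)"
  using assms by (metis dot_lmul_matrix transpose_matrix_vector)

text \<open>If the residual \<open>r = A *v g - \<mu> *\<^sub>R g\<close> were nonzero, moving from
  \<open>g\<close> slightly in the direction \<open>- r\<close> would make the quadratic form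
  \<open>Q\<close> negative. As this applies to every minimizer \<open>g\<close>, it also settles
  the equality case of the Rayleigh bound.\<close>

lemma rayleigh_minimizer_eigenvector:
  fixes A :: "real^'n^'n"
  assumes sym: "transpose A = A"
    and S: "subspace S" and inv: "\<And>x. x \<in> S \<Longrightarrow> A *v x \<in> S"
    and min: "\<And>x. x \<in> S \<Longrightarrow> \<mu> * (x \<bullet> x) \<le> x \<bullet> (A *v x)"
    and g: "g \<in> S" "g \<bullet> (A *v g) \<le> \<mu> * (g \<bullet> g)"
  shows "A *v g = \<mu> *\<^sub>R g"
proof (rule ccontr)
  assume neq: "A *v g \<noteq> \<mu> *\<^sub>R g"
  define r where "r = A *v g - \<mu> *\<^sub>R g"
  define Q where "Q x = x \<bullet> (A *v x) - \<mu> * (x \<bullet> x)" for x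
  have rS: "r \<in> S"
    unfolding r_def using S inv g by (intro subspace_diff subspace_scale) auto
  have rpos: "r \<bullet> r > 0"
    using neq by (simp add: r_def)
  have Qr: "Q r \<ge> 0"
    using min[OF rS] by (simp add: Q_def)
  have expand: "Q (g + t *\<^sub>R r) = Q g + 2 * t * (r \<bullet> r) + t\<^sup>2 * Q r" for t
  proof -
    have "g \<bullet> (A *v r) = r \<bullet> (A *v g)"
      using symmetric_matrix_inner[OF sym, of g r] by (simp add: inner_commute)
    moreover have "r \<bullet> (A *v g) = r \<bullet> r + \<mu> * (r \<bullet> g)"
      using inner_diff_right[of r "A *v g" "\<mu> *\<^sub>R g"] by (simp flip: r_def)
    ultimately show ?thesis
      by (simp add: Q_def matrix_vector_right_distrib inner_add_left inner_add_right
          matrix_vector_mult_scaleR inner_commute[of g r] power2_eq_square algebra_simps)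
  qed
  \<comment> \<open>This \<open>t\<close> minimizes
    \<open>2 * t * (r \<bullet> r) + t\<^sup>2 * (Q r + 1)\<close>; the summand 1 keeps the
    denominator positive when \<open>Q r = 0\<close>.\<close>
  define t where "t = - (r \<bullet> r) / (Q r + 1)"
  have "g + t *\<^sub>R r \<in> S"
    using S g rS by (intro subspace_add subspace_scale) auto
  then have "0 \<le> Q (g + t *\<^sub>R r)"
    using min by (simp add: Q_def)
  also have "\<dots> \<le> 2 * t * (r \<bullet> r) + t\<^sup>2 * (Q r + 1)"
    using g(2) unfolding expand by (simp add: Q_def algebra_simps add_increasing2)
  also have "t\<^sup>2 * (Q r + 1) = - t * (r \<bullet> r)"
    using Qr by (simp add: t_def power2_eq_square)
  also have "2 * t * (r \<bullet> r) + - t * (r \<bullet> r) = t * (r \<bullet> r)"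
    by simp
  also have "\<dots> < 0"
    using rpos Qr by (intro mult_neg_pos) (auto simp: t_def intro!: divide_neg_pos)
  finally show False by simp
qed

text \<open>The quadratic form attains its minimum on the compact unit sphere of \<open>S\<close>;
  homogeneity extends the bound to all of \<open>S\<close>.\<close>

lemma rayleigh_minimizer_exists:
  fixes A :: "real^'n^'n"
  assumes sym: "transpose A = A"
    and S: "subspace S" and inv: "\<And>x. x \<in> S \<Longrightarrow> A *v x \<in> S"
    and ne: "g \<in> S" "g \<noteq> 0"
  obtains \<mu> x where "x \<in> S" "x \<noteq> 0" "A *v x = \<mu> *\<^sub>R x"
    "\<And>y. y \<in> S \<Longrightarrow> \<mu> * (y \<bullet> y) \<le> y \<bullet> (A *v y)"
proof -
  let ?U = "S \<inter> sphere 0 1"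
  have unit: "(1 / norm y) *\<^sub>R y \<in> ?U" if "y \<in> S" "y \<noteq> 0" for y
    using that S by (auto intro: subspace_scale)
  have "compact ?U"
    using S by (intro closed_Int_compact closed_subspace) auto
  moreover have "?U \<noteq> {}"
    using unit[OF ne] by blast
  moreover have "continuous_on ?U (\<lambda>y. y \<bullet> (A *v y))"
    by (intro continuous_on_inner continuous_on_id linear_continuous_on matrix_vector_mul_bounded_linear)
  ultimately have "\<exists>x\<in>?U. \<forall>y\<in>?U. x \<bullet> (A *v x) \<le> y \<bullet> (A *v y)"
    by (rule continuous_attains_inf)
  then obtain x where x: "x \<in> ?U" "\<And>y. y \<in> ?U \<Longrightarrow> x \<bullet> (A *v x) \<le> y \<bullet> (A *v y)"
    by blast
  define \<mu> where "\<mu> = x \<bullet> (A *v x)"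
  have min: "\<mu> * (y \<bullet> y) \<le> y \<bullet> (A *v y)" if "y \<in> S" for y
  proof (cases "y = 0")
    case False
    have "\<mu> \<le> (y \<bullet> (A *v y)) / (norm y)\<^sup>2"
      using x(2)[OF unit[OF that False]]
      by (simp add: \<mu>_def matrix_vector_mult_scaleR power2_eq_square field_simps)
    then show ?thesis
      using False by (simp add: field_simps power2_norm_eq_inner)
  qed simp
  have xx: "x \<bullet> x = 1" using x(1) by (simp add: norm_eq_1)
  show thesis
  proof
    show "x \<in> S" using x(1) by simp
    show "x \<noteq> 0" using xx by auto
    show "A *v x = \<mu> *\<^sub>R x"
      by (rule rayleigh_minimizer_eigenvector[OF sym S inv min])
        (use x(1) xx in \<open>simp_all add: \<mu>_def\<close>)
  qed (rule min)
qed

text \<open>Induction along a walk starting at \<open>x\<close>. Connectedness is used throughout in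
  this form.\<close>

lemma connected_graph_closed_UNIV:
  assumes "connected_graph E" "x \<in> Z" "\<And>u v. u \<in> Z \<Longrightarrow> E u v \<Longrightarrow> v \<in> Z"
  shows "Z = UNIV"
proof -
  have walk: "successively E xs \<Longrightarrow> xs \<noteq> [] \<Longrightarrow> hd xs \<in> Z \<Longrightarrow> last xs \<in> Z" for xs
  proof (induction xs)
    case (Cons a xs)
    then show ?case using assms(3) by (cases xs) auto
  qed simp
  have "v \<in> Z" for v
    using assms(1,2) walk unfolding connected_graph_def is_walk_def by metis
  then show ?thesis by blast
qed

text \<open>The Laplacian acting on functions, written with differences so that energies and the
  minimum principle can be read off. With this sign, superharmonic means that the value is
  nonnegative.\<close>

definition graph_laplace :: "('v::finite \<Rightarrow> 'v \<Rightarrow> bool) \<Rightarrow> ('v \<Rightarrow> real) \<Rightarrow> 'v \<Rightarrow> real" where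
  "graph_laplace E f v = (\<Sum>w\<in>neighbors E v. f v - f w)"

lemma laplacian_mult_vec: "(laplacian E *v x) $ v = graph_laplace E (($) x) v"
proof -
  have "(laplacian E *v x) $ v =
      (\<Sum>w\<in>UNIV. (if v = w then real (card (neighbors E v)) * x $ w else 0)) -
      (\<Sum>w\<in>UNIV. if E v w then x $ w else 0)"
    unfolding laplacian_def degree_matrix_def adjacency_matrix_def matrix_vector_mult_def
    by (simp only: vec_lambda_beta vector_minus_component left_diff_distrib sum_subtractf)
      (intro arg_cong2[where f = minus] sum.cong; simp)
  also have "\<dots> = real (card (neighbors E v)) * x $ v - (\<Sum>w\<in>neighbors E v. x $ w)"
    by (simp add: neighbors_def sum.If_cases)
  finally show ?thesis
    by (simp add: graph_laplace_def sum_subtractf)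
qed

lemma transpose_laplacian:
  assumes "symp E"
  shows "transpose (laplacian E) = laplacian E"
  using assms by (auto simp: vec_eq_iff transpose_def laplacian_def degree_matrix_def
      adjacency_matrix_def dest: sympD)

lemma graph_laplace_double_sum:
  "(\<Sum>v\<in>UNIV. g v * graph_laplace E f v) = (\<Sum>v\<in>UNIV. \<Sum>w\<in>UNIV. if E v w then g v * (f v - f w) else 0)"
  by (auto simp: graph_laplace_def neighbors_def sum_distrib_left sum.If_cases intro!: sum.cong)

text \<open>Discrete Green formula: average the double sum with its copy in which \<open>v\<close>
  and \<open>w\<close> are swapped. The sum runs over ordered pairs, so every edge is counted
  twice.\<close>

lemma graph_laplace_green:
  assumes "symp E"
  shows "(\<Sum>v\<in>UNIV. g v * graph_laplace E f v) =
    (\<Sum>v\<in>UNIV. \<Sum>w\<in>UNIV. if E v w then (g v - g w) * (f v - f w) else 0) / 2"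
proof -
  let ?a = "\<lambda>v w. if E v w then g v * (f v - f w) else 0"
  have "(\<Sum>v\<in>UNIV. \<Sum>w\<in>UNIV. ?a v w) = (\<Sum>v\<in>UNIV. \<Sum>w\<in>UNIV. ?a w v)"
    by (rule sum.swap)
  moreover have "(\<Sum>v\<in>UNIV. \<Sum>w\<in>UNIV. if E v w then (g v - g w) * (f v - f w) else 0) =
      (\<Sum>v\<in>UNIV. \<Sum>w\<in>UNIV. ?a v w + ?a w v)"
    using assms by (intro sum.cong refl) (auto dest: sympD simp: algebra_simps)
  ultimately show ?thesis
    by (simp add: graph_laplace_double_sum sum.distrib)
qed

lemma graph_laplace_sum_zero:
  assumes "symp E"
  shows "(\<Sum>v\<in>UNIV. graph_laplace E f v) = 0"
  using graph_laplace_green[OF assms, of "\<lambda>_. 1" f] by (simp cong: if_cong)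

lemma graph_laplace_energy_nonneg:
  assumes "symp E"
  shows "0 \<le> (\<Sum>v\<in>UNIV. f v * graph_laplace E f v)"
  unfolding graph_laplace_green[OF assms] by (auto intro!: divide_nonneg_nonneg sum_nonneg)

text \<open>The energy of \<open>f\<close> vanishes, so \<open>f\<close> agrees across every
  edge.\<close>

lemma harmonic_constant:
  assumes "symp E" "connected_graph E" "\<And>v. graph_laplace E f v = 0"
  shows "f u = f v"
proof -
  have "(\<Sum>v\<in>UNIV. \<Sum>w\<in>UNIV. if E v w then (f v - f w) * (f v - f w) else 0) = 0"
    using graph_laplace_green[OF assms(1), of f f] assms(3) by simp
  then have inner: "(\<Sum>w\<in>UNIV. if E v w then (f v - f w) * (f v - f w) else 0) = 0" for v
    by (subst (asm) sum_nonneg_eq_0_iff) (auto intro!: sum_nonneg)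
  have "f v = f w" if "E v w" for v w
    using inner[of v] that by (subst (asm) sum_nonneg_eq_0_iff) (auto split: if_splits)
  then have "{w. f w = f v} = UNIV"
    using connected_graph_closed_UNIV[OF assms(2), of v "{w. f w = f v}"] by auto
  then show ?thesis by auto
qed

text \<open>A harmonic function of mean zero vanishes, so \<mu> is positive. The sorted eigenvalue
  list contains 0, from the constant vector, as well as \<mu>; hence \<mu> occurs at an index of at
  least 1, and \<open>lambda2 E\<close> is entry 1.\<close>

lemma lambda2_le_eigenvalue:
  assumes E: "symp E" "connected_graph E"
    and x: "x \<noteq> 0" "laplacian E *v x = \<mu> *\<^sub>R x" and sum0: "(\<Sum>v\<in>UNIV. x $ v) = 0"
  shows "lambda2 E \<le> \<mu>"
proof -
  let ?L = "laplacian E"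
  have lap: "graph_laplace E (($) x) v = \<mu> * x $ v" for v
    using x(2) laplacian_mult_vec[of E x v] by simp
  have energy: "0 \<le> \<mu> * (\<Sum>v\<in>UNIV. (x $ v)\<^sup>2)"
    using graph_laplace_energy_nonneg[OF E(1), of "($) x"]
    by (simp add: lap sum_distrib_left power2_eq_square algebra_simps)
  have pos: "0 < (\<Sum>v\<in>UNIV. (x $ v)\<^sup>2)"
    using x(1) by (auto simp: vec_eq_iff intro!: sum_pos2)
  have "\<mu> \<noteq> 0"
  proof
    assume "\<mu> = 0"
    then have const: "x $ u = x $ v" for u v
      using harmonic_constant[OF E, of "($) x"] lap by simp
    then have "(\<Sum>v\<in>UNIV. x $ v) = (\<Sum>v\<in>(UNIV::'a set). x $ u)" for u
      by (intro sum.cong) auto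
    then have "x $ u = 0" for u
      using sum0 by simp
    then show False using x(1) by (simp add: vec_eq_iff)
  qed
  then have \<mu>: "0 < \<mu>"
    using energy pos by (simp add: zero_le_mult_iff)
  have fin: "finite (eigenvalues ?L)"
    by (rule finite_eigenvalues_symmetric[OF transpose_laplacian[OF E(1)]])
  define M where "M = (\<Sum>\<nu>\<in>eigenvalues ?L. replicate_mset (dim (eigenspace ?L \<nu>)) \<nu>)"
  have inM: "\<nu> \<in># M" if "is_eigenvector ?L \<nu> y" for \<nu> y
  proof -
    have "y \<in> eigenspace ?L \<nu>" "y \<noteq> 0"
      using that by (auto simp: is_eigenvector_def)
    then have "dim (eigenspace ?L \<nu>) \<noteq> 0"
      by (auto simp: dim_eq_0)
    moreover have "\<nu> \<in> eigenvalues ?L"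
      using that by (auto simp: eigenvalues_def)
    ultimately show ?thesis
      using fin by (auto simp: M_def set_mset_sum)
  qed
  have "is_eigenvector ?L 0 (1 :: real^'a)"
    by (simp add: is_eigenvector_def eigenspace_def vec_eq_iff laplacian_mult_vec graph_laplace_def)
  from inM[OF this] have "0 \<in> set (eigenvalue_list ?L)"
    by (simp add: eigenvalue_list_def M_def)
  then obtain i where i: "i < length (eigenvalue_list ?L)" "eigenvalue_list ?L ! i = 0"
    by (metis in_set_conv_nth)
  have "\<mu> \<in> set (eigenvalue_list ?L)"
    using inM[of \<mu> x] x by (simp add: eigenvalue_list_def M_def is_eigenvector_def eigenspace_def)
  then obtain j where j: "j < length (eigenvalue_list ?L)" "eigenvalue_list ?L ! j = \<mu>"
    by (metis in_set_conv_nth)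
  have sorted: "sorted (eigenvalue_list ?L)"
    by (simp add: eigenvalue_list_def)
  have "j \<noteq> 0"
  proof
    assume "j = 0"
    then show False using sorted_nth_mono[OF sorted, of j i] i j \<mu> by simp
  qed
  then show ?thesis
    unfolding lambda2_def using sorted_nth_mono[OF sorted, of 1 j] j by simp
qed

text \<open>The functions of mean zero form an invariant subspace, on which the minimum of the
  Rayleigh quotient is an eigenvalue and hence at least \<open>lambda2 E\<close>. The second part is
  the equality case, needed for the nodal domain argument.\<close>

lemma lambda2_rayleigh:
  fixes E :: "'v::finite \<Rightarrow> 'v \<Rightarrow> bool"
  assumes E: "symp E" "connected_graph E" and sum0: "(\<Sum>v\<in>UNIV. g v) = 0"
  shows "lambda2 E * (\<Sum>v\<in>UNIV. (g v)\<^sup>2) \<le> (\<Sum>v\<in>UNIV. g v * graph_laplace E g v)"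
    and "(\<Sum>v\<in>UNIV. g v * graph_laplace E g v) \<le> lambda2 E * (\<Sum>v\<in>UNIV. (g v)\<^sup>2) \<Longrightarrow>
      graph_laplace E g v = lambda2 E * g v"
proof -
  define S where "S = {x :: real^'v. (\<Sum>v\<in>UNIV. x $ v) = 0}"
  let ?L = "laplacian E"
  have S: "subspace S"
    by (auto simp: S_def subspace_def sum.distrib sum_distrib_left[symmetric])
  have inv: "?L *v x \<in> S" for x
    by (simp add: S_def laplacian_mult_vec graph_laplace_sum_zero[OF E(1)])
  note T = transpose_laplacian[OF E(1)]
  have min: "lambda2 E * (y \<bullet> y) \<le> y \<bullet> (?L *v y)" if "y \<in> S" for y
  proof (cases "y = 0")
    case False
    obtain \<mu> x where x: "x \<in> S" "x \<noteq> 0" "?L *v x = \<mu> *\<^sub>R x"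
      "\<And>y. y \<in> S \<Longrightarrow> \<mu> * (y \<bullet> y) \<le> y \<bullet> (?L *v y)"
      using rayleigh_minimizer_exists[OF T S inv \<open>y \<in> S\<close> False] by blast
    have "lambda2 E \<le> \<mu>"
      using lambda2_le_eigenvalue[OF E x(2,3)] x(1) by (simp add: S_def)
    then have "lambda2 E * (y \<bullet> y) \<le> \<mu> * (y \<bullet> y)"
      by (intro mult_right_mono) auto
    then show ?thesis
      using x(4)[OF that] by linarith
  qed simp
  define y where "y = (\<chi> v. g v)"
  have y: "y \<in> S" using sum0 by (simp add: y_def S_def)
  have yn: "($) y = g" by (simp add: y_def fun_eq_iff)
  have n: "y \<bullet> y = (\<Sum>v\<in>UNIV. (g v)\<^sup>2)"
    by (simp add: y_def inner_vec_def power2_eq_square)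
  have e: "y \<bullet> (?L *v y) = (\<Sum>v\<in>UNIV. g v * graph_laplace E g v)"
    using yn by (simp add: inner_vec_def laplacian_mult_vec)
  show "lambda2 E * (\<Sum>v\<in>UNIV. (g v)\<^sup>2) \<le> (\<Sum>v\<in>UNIV. g v * graph_laplace E g v)"
    using min[OF y] by (simp only: n e)
  assume "(\<Sum>v\<in>UNIV. g v * graph_laplace E g v) \<le> lambda2 E * (\<Sum>v\<in>UNIV. (g v)\<^sup>2)"
  then have "y \<bullet> (?L *v y) \<le> lambda2 E * (y \<bullet> y)"
    unfolding n e .
  with y min have "?L *v y = lambda2 E *\<^sub>R y"
    by (intro rayleigh_minimizer_eigenvector[OF T S inv]) auto
  from arg_cong[OF this, of "\<lambda>z. z $ v"] show "graph_laplace E g v = lambda2 E * g v"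
    using yn by (simp add: laplacian_mult_vec y_def)
qed

text \<open>Minimum principle: at a negative minimum over \<open>K\<close> no neighbor has a smaller
  value, so superharmonicity forces equality at all neighbors. The set of minimum points is then
  closed under edges, yet it misses \<open>a\<close>.\<close>

lemma superharmonic_nonneg:
  assumes conn: "connected_graph E"
    and K: "\<And>v w. v \<in> K \<Longrightarrow> E v w \<Longrightarrow> w \<in> insert a K" and a: "a \<notin> K"
    and super: "\<And>v. v \<in> K \<Longrightarrow> 0 \<le> graph_laplace E q v" and qa: "0 \<le> q a"
    and v: "v \<in> K"
  shows "0 \<le> q v"
proof (rule ccontr)
  assume neg: "\<not> 0 \<le> q v"
  define m where "m = Min (q ` K)"
  have m: "m \<le> q w" if "w \<in> K" for w
    using that by (simp add: m_def)
  have "m \<in> q ` K" using v unfolding m_def by (intro Min_in) auto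
  then obtain u where u: "u \<in> K" "q u = m" by auto
  have m0: "m < 0" using m[OF v] neg by simp
  have "w \<in> {w \<in> K. q w = m}" if "z \<in> {w \<in> K. q w = m}" "E z w" for z w
  proof -
    have le: "q z - q y \<le> 0" if "y \<in> neighbors E z" for y
      using that K[of z y] \<open>z \<in> _\<close> m m0 qa by (auto simp: neighbors_def)
    have "graph_laplace E q z = 0"
      using super[of z] that(1) le unfolding graph_laplace_def by (simp add: order_antisym sum_nonpos)
    then have "(\<Sum>y\<in>neighbors E z. q y - q z) = 0"
      by (simp add: graph_laplace_def sum_subtractf)
    then have "q w - q z = 0"
      using le that(2) by (subst (asm) sum_nonneg_eq_0_iff) (auto simp: neighbors_def)
    then show ?thesis
      using K[of z w] that m0 qa by auto
  qed
  then have "{w \<in> K. q w = m} = UNIV"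
    by (intro connected_graph_closed_UNIV[OF conn, of u]) (use u in blast)+
  then show False using a by blast
qed

section \<open>Hitting times\<close>

text \<open>Outside \<open>S\<close> the time 0 does not count, so consuming the first map shifts
  the set of hitting times by one.\<close>

lemma hitting_time_Stream:
  assumes "v \<notin> S"
  shows "hitting_time S v (f ## \<omega>) = eSuc (hitting_time S (f v) \<omega>)"
proof -
  let ?A = "{enat n | n. random_walk (f v) \<omega> n \<in> S}"
  have "x \<in> {enat n | n. random_walk v (f ## \<omega>) n \<in> S} \<longleftrightarrow> x \<in> eSuc ` ?A" for x
  proof
    assume "x \<in> {enat n | n. random_walk v (f ## \<omega>) n \<in> S}"
    then obtain n where n: "x = enat n" "random_walk v (f ## \<omega>) n \<in> S" by auto
    with assms obtain k where "n = Suc k" by (cases n) auto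
    with n show "x \<in> eSuc ` ?A"
      by (auto simp: random_walk_Stream eSuc_enat[symmetric] simp del: random_walk.simps)
  next
    assume "x \<in> eSuc ` ?A"
    then show "x \<in> {enat n | n. random_walk v (f ## \<omega>) n \<in> S}"
      using random_walk_Stream[of v f \<omega>] by (auto simp: eSuc_enat simp del: random_walk.simps)
  qed
  then have eq: "{enat n | n. random_walk v (f ## \<omega>) n \<in> S} = eSuc ` ?A" by blast
  \<comment> \<open>The infimum of a nonempty set is attained and passes through
    \<open>eSuc\<close>; for the empty set both sides are infinite.\<close>
  have "Inf (eSuc ` ?A) = eSuc (Inf ?A)"
  proof (cases "?A = {}")
    case False
    then have "Inf ?A \<in> ?A"
      by (metis (no_types, lifting) ex_in_conv Inf_enat_def LeastI)
    moreover have "eSuc (Inf ?A) \<le> eSuc a" if "a \<in> ?A" for a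
      unfolding eSuc_ile_mono using that by (rule Inf_lower)
    ultimately show ?thesis
      by (intro order_antisym Inf_greatest Inf_lower imageI) (blast | assumption)+
  qed (simp add: top_enat_def)
  then show ?thesis
    unfolding hitting_time_def eq .
qed

lemma measurable_hitting_time [measurable]:
  fixes E :: "'v::finite \<Rightarrow> 'v \<Rightarrow> bool"
  shows "(\<lambda>\<omega>. hitting_time S v \<omega>) \<in> walk_space E \<rightarrow>\<^sub>M count_space UNIV"
proof -
  \<comment> \<open>A first index given by \<open>LEAST\<close> is measurable by the standard rules,
    unlike an infimum over a set depending on \<omega>.\<close>
  have eq: "hitting_time S v \<omega> = (if \<exists>n. random_walk v \<omega> n \<in> S
      then enat (LEAST n. random_walk v \<omega> n \<in> S) else \<infinity>)" for \<omega>
  proof (cases "\<exists>n. random_walk v \<omega> n \<in> S")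
    case True
    then have "random_walk v \<omega> (LEAST n. random_walk v \<omega> n \<in> S) \<in> S"
      by (rule LeastI_ex)
    then have "Inf {enat n | n. random_walk v \<omega> n \<in> S} = enat (LEAST n. random_walk v \<omega> n \<in> S)"
      by (intro order_antisym Inf_greatest) (auto intro!: Inf_lower Least_le)
    with True show ?thesis by (simp add: hitting_time_def)
  qed (simp add: hitting_time_def top_enat_def)
  show ?thesis unfolding eq by measurable
qed

lemma hit_mem: "v \<in> S \<Longrightarrow> hit E S v = 0"
proof -
  assume "v \<in> S"
  then have "hitting_time S v \<omega> = 0" for \<omega>
    unfolding hitting_time_def zero_enat_def
    by (intro order_antisym Inf_lower Inf_greatest) (auto intro!: exI[of _ 0])
  then show ?thesis by (simp add: hit_def)
qed

text \<open>First-step analysis: split off the first random map, whose value at \<open>v\<close> is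
  uniform on the neighbors. In \<open>ennreal\<close> the identity makes sense for infinite
  expectations too.\<close>

lemma hit_first_step:
  fixes E :: "'v::finite \<Rightarrow> 'v \<Rightarrow> bool"
  assumes v: "v \<notin> S" and ne: "neighbors E v \<noteq> {}"
  shows "hit E S v = 1 + (\<Sum>w\<in>neighbors E v. hit E S w) / card (neighbors E v)"
proof -
  let ?M = "measure_pmf (step_maps E)"
  interpret prob_space "walk_space E"
    unfolding walk_space_def by (rule prob_space.prob_space_stream_space[OF prob_space_measure_pmf])
  have [measurable]: "(\<lambda>\<omega>. ennreal_of_enat (hitting_time S u \<omega>)) \<in> borel_measurable (walk_space E)" for u
    by measurable
  have "hit E S v = (\<integral>\<^sup>+ f. \<integral>\<^sup>+ \<omega>. ennreal_of_enat (hitting_time S v (f ## \<omega>)) \<partial>walk_space E \<partial>?M)"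
    unfolding hit_def walk_space_def
    by (rule prob_space.nn_integral_stream_space[OF prob_space_measure_pmf])
      (simp flip: walk_space_def)
  also have "\<dots> = (\<integral>\<^sup>+ f. 1 + hit E S (f v) \<partial>?M)"
    unfolding hitting_time_Stream[OF v] hit_def
    by (intro nn_integral_cong) (simp add: ennreal_of_enat_eSuc nn_integral_add emeasure_space_1)
  also have "\<dots> = 1 + (\<integral>\<^sup>+ f. hit E S (f v) \<partial>?M)"
    by (simp add: nn_integral_add)
  also have "(\<integral>\<^sup>+ f. hit E S (f v) \<partial>?M) =
      (\<integral>\<^sup>+ u. hit E S u \<partial>measure_pmf (map_pmf (\<lambda>f. f v) (step_maps E)))"
    by simp
  also have "map_pmf (\<lambda>f. f v) (step_maps E) = pmf_of_set (neighbors E v)"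
    unfolding step_maps_def by (rule Pi_pmf_component[of UNIV v, simplified])
  also have "(\<integral>\<^sup>+ u. hit E S u \<partial>measure_pmf (pmf_of_set (neighbors E v))) =
      (\<Sum>w\<in>neighbors E v. hit E S w) / card (neighbors E v)"
    using ne by (simp add: nn_integral_pmf_of_set)
  finally show ?thesis .
qed


text \<open>The first-step identity multiplied by the degree; finiteness allows the passage to real
  numbers. The hitting time thus is a barrier whose Laplacian is at least 1 off
  \<open>S\<close>.\<close>

lemma graph_laplace_hit:
  fixes E :: "'v::finite \<Rightarrow> 'v \<Rightarrow> bool"
  assumes v: "v \<notin> S" and ne: "neighbors E v \<noteq> {}" and fin: "\<And>w. hit E S w < \<top>"
  shows "graph_laplace E (\<lambda>w. enn2real (hit E S w)) v = real (card (neighbors E v))"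
proof -
  define \<tau> where "\<tau> w = enn2real (hit E S w)" for w
  have \<tau>0: "0 \<le> \<tau> w" for w by (simp add: \<tau>_def)
  have hit: "hit E S w = ennreal (\<tau> w)" for w
    using fin[of w] by (simp add: \<tau>_def)
  let ?N = "neighbors E v"
  have d: "0 < real (card ?N)" using ne by (simp add: card_gt_0_iff)
  have "ennreal (\<tau> v) = ennreal 1 + ennreal (\<Sum>w\<in>?N. \<tau> w) / ennreal (real (card ?N))"
    using hit_first_step[OF v ne] by (simp add: hit \<tau>0 ennreal_of_nat_eq_real_of_nat)
  also have "\<dots> = ennreal (1 + (\<Sum>w\<in>?N. \<tau> w) / real (card ?N))"
    using d by (simp add: divide_ennreal sum_nonneg \<tau>0 ennreal_plus[symmetric] del: ennreal_plus ennreal_1)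
  finally have "\<tau> v = 1 + (\<Sum>w\<in>?N. \<tau> w) / real (card ?N)"
    using \<tau>0 d by (subst (asm) ennreal_inj) (auto intro!: add_nonneg_nonneg divide_nonneg_nonneg sum_nonneg)
  then show ?thesis
    using d unfolding \<tau>_def[symmetric] by (simp add: graph_laplace_def sum_subtractf field_simps)
qed

text \<open>Against an upper bound on the hitting time, this excludes attachments close to the ends
  of the path.\<close>

lemma hit_ge_1:
  assumes "v \<notin> S" "neighbors E v \<noteq> {}"
  shows "1 \<le> hit E S v"
  unfolding hit_first_step[OF assms] by simp

section \<open>Eigenfunctions on a path with attached graphs\<close>

lemma graph_laplace_uminus: "graph_laplace E (\<lambda>v. - f v) v = - graph_laplace E f v"
  by (simp add: graph_laplace_def flip: sum_negf)

text \<open>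
  The path is \<open>p 0, \<dots>, p D\<close>, and \<open>b v\<close> is the index of the path vertex at which the branch
  containing \<open>v\<close> is attached.
\<close>

locale branched_path =
  fixes E :: "'v::finite \<Rightarrow> 'v \<Rightarrow> bool" and p :: "nat \<Rightarrow> 'v" and b :: "'v \<Rightarrow> nat" and D :: nat
  assumes sym: "symp E" and conn: "connected_graph E"
    and b_p: "k \<le> D \<Longrightarrow> b (p k) = k"
    and b_le: "b v \<le> D"
    and edge_p: "k < D \<Longrightarrow> E (p k) (p (Suc k))"
    and edge: "E u v \<Longrightarrow> b u = b v \<or>
      (\<exists>k<D. (u = p k \<and> v = p (Suc k)) \<or> (u = p (Suc k) \<and> v = p k))"
begin

text \<open>Transfers statements about the start \<open>p 0\<close> to the end
  \<open>p D\<close>.\<close>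

lemma reversed: "branched_path E (\<lambda>k. p (D - k)) (\<lambda>v. D - b v) D"
proof
  show "symp E" "connected_graph E" by (rule sym, rule conn)
  show "D - b (p (D - k)) = k" if "k \<le> D" for k
    using that b_p[of "D - k"] by simp
  show "D - b v \<le> D" for v by simp
  show "E (p (D - k)) (p (D - Suc k))" if "k < D" for k
    using that edge_p[of "D - Suc k"] sym by (auto simp: Suc_diff_Suc dest: sympD)
  show "D - b u = D - b v \<or> (\<exists>k<D. (u = p (D - k) \<and> v = p (D - Suc k)) \<or>
      (u = p (D - Suc k) \<and> v = p (D - k)))" if uv: "E u v" for u v
    using edge[OF uv]
  proof
    assume "\<exists>k<D. (u = p k \<and> v = p (Suc k)) \<or> (u = p (Suc k) \<and> v = p k)"
    then obtain k where "k < D" "(u = p k \<and> v = p (Suc k)) \<or> (u = p (Suc k) \<and> v = p k)" by blast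
    then show ?thesis
      by (intro disjI2 exI[of _ "D - Suc k"]) (auto simp: Suc_diff_Suc)
  qed simp
qed

text \<open>Discrete divergence theorem: Green's formula with the indicator \<open>g\<close> of
  \<open>b v \<le> k\<close>. The only edge leaving this set is the path edge between
  \<open>p k\<close> and \<open>p (Suc k)\<close>.\<close>

lemma flow:
  assumes eig: "\<And>v. graph_laplace E f v = l * f v" and k: "k < D"
  shows "f (p k) - f (p (Suc k)) = l * (\<Sum>v | b v \<le> k. f v)"
proof -
  define g where "g v = (if b v \<le> k then 1 else 0 :: real)" for v
  define h where "h = (\<lambda>(v, w). if E v w then (g v - g w) * (f v - f w) else 0)"
  let ?x = "p k" and ?y = "p (Suc k)"
  have bx: "b ?x = k" "b ?y = Suc k" using k by (auto simp: b_p)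
  then have xy: "?x \<noteq> ?y" by auto
  have "l * (\<Sum>v | b v \<le> k. f v) = (\<Sum>v\<in>UNIV. g v * graph_laplace E f v)"
    by (auto simp: eig g_def sum_distrib_left sum.If_cases if_distrib[of "\<lambda>x. x * _"] cong: if_cong)
  also have "\<dots> = (\<Sum>z\<in>UNIV \<times> UNIV. h z) / 2"
    by (simp add: graph_laplace_green[OF sym] sum.cartesian_product h_def)
  \<comment> \<open>The two orientations of the crossing edge cancel the factor 1/2.\<close>
  also have "(\<Sum>z\<in>UNIV \<times> UNIV. h z) = (\<Sum>z\<in>{(?x, ?y), (?y, ?x)}. h z)"
  proof (rule sum.mono_neutral_right)
    show "\<forall>z\<in>UNIV \<times> UNIV - {(?x, ?y), (?y, ?x)}. h z = 0"
    proof
      fix y assume y: "y \<in> UNIV \<times> UNIV - {(?x, ?y), (?y, ?x)}"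
      obtain v w where vw: "y = (v, w)" by (cases y)
      with y have z: "(v, w) \<notin> {(?x, ?y), (?y, ?x)}" by blast
      have "h (v, w) = 0"
      proof (cases "E v w")
        case True
        then have "g v = g w"
          using edge[OF True] z
        proof (elim disjE exE conjE)
          fix j assume j: "j < D" "v = p j" "w = p (Suc j)"
          then have "j \<noteq> k" using z by auto
          then show ?thesis using j by (auto simp: g_def b_p)
        next
          fix j assume j: "j < D" "v = p (Suc j)" "w = p j"
          then have "j \<noteq> k" using z by auto
          then show ?thesis using j by (auto simp: g_def b_p)
        qed (simp add: g_def)
        then show ?thesis by (simp add: h_def)
      qed (simp add: h_def)
      then show "h y = 0" by (simp add: vw)
    qed
  qed auto
  also have "\<dots> = 2 * (f ?x - f ?y)"
    using xy edge_p[OF k] sympD[OF sym edge_p[OF k]] by (simp add: h_def g_def bx)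
  finally show ?thesis by simp
qed

text \<open>The test function is \<open>b\<close> minus its mean over all vertices. Only the
  \<open>D\<close> path edges contribute to its energy, each by 1, while the path vertices alone
  give the sum of squares at least \<open>D (D + 1) (D + 2) / 12\<close>.\<close>

lemma rayleigh_bound:
  assumes ray: "\<And>g. (\<Sum>v\<in>UNIV. g v) = 0 \<Longrightarrow>
      l * (\<Sum>v\<in>UNIV. (g v)\<^sup>2) \<le> (\<Sum>v\<in>UNIV. g v * graph_laplace E g v)"
    and l: "0 \<le> l"
  shows "l * (real D)\<^sup>2 \<le> 12"
proof (cases "D = 0")
  case False
  define c where "c = (\<Sum>v\<in>UNIV. real (b v)) / real CARD('v)"
  define g where "g v = real (b v) - c" for v
  define h where "h = (\<lambda>(v, w). if E v w then (g v - g w) * (g v - g w) else 0)"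
  define Z where "Z = (\<lambda>j. (p j, p (Suc j))) ` {..<D} \<union> (\<lambda>j. (p (Suc j), p j)) ` {..<D}"
  have sq: "(\<Sum>j\<le>n. (real j - c)\<^sup>2) =
      real n * (real n + 1) * (2 * real n + 1) / 6 - c * (real n * (real n + 1)) + (real n + 1) * c\<^sup>2" for n
    by (induction n) (auto simp: field_simps power2_eq_square)
  \<comment> \<open>The sum of squares about \<open>c\<close> exceeds the one about the midpoint
    \<open>D / 2\<close> of the path by exactly this amount.\<close>
  have "0 \<le> (real D + 1) * (c - real D / 2)\<^sup>2" by simp
  then have "real D * (real D + 1) * (real D + 2) / 12 \<le> (\<Sum>j\<le>D. (real j - c)\<^sup>2)"
    unfolding sq by (simp add: field_simps power2_eq_square)
  also have "\<dots> = (\<Sum>v\<in>p ` {..D}. (g v)\<^sup>2)"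
    by (subst sum.reindex) (auto intro!: inj_on_inverseI[of _ b] sum.cong simp: b_p g_def)
  also have "\<dots> \<le> (\<Sum>v\<in>UNIV. (g v)\<^sup>2)"
    by (intro sum_mono2) auto
  finally have var: "real D * (real D + 1) * (real D + 2) / 12 \<le> (\<Sum>v\<in>UNIV. (g v)\<^sup>2)" .
  have "(\<Sum>v\<in>UNIV. g v * graph_laplace E g v) = (\<Sum>z\<in>UNIV \<times> UNIV. h z) / 2"
    by (simp add: graph_laplace_green[OF sym] sum.cartesian_product h_def)
  also have "(\<Sum>z\<in>UNIV \<times> UNIV. h z) = (\<Sum>z\<in>Z. h z)"
  proof (rule sum.mono_neutral_right)
    show "\<forall>z\<in>UNIV \<times> UNIV - Z. h z = 0"
    proof clarify
      fix v w assume z: "(v, w) \<notin> Z"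
      have "b v = b w" if "E v w"
        using edge[OF that] z by (auto simp: Z_def)
      then show "h (v, w) = 0" by (simp add: h_def g_def)
    qed
  qed auto
  also have "\<dots> \<le> real (card Z) * 1"
    by (intro sum_bounded_above) (auto simp: h_def g_def Z_def b_p)
  also have "card Z \<le> D + D"
    unfolding Z_def by (rule order_trans[OF card_Un_le])
      (intro add_mono order_trans[OF card_image_le]; simp)
  finally have "(\<Sum>v\<in>UNIV. g v * graph_laplace E g v) \<le> real D" by simp
  moreover have "(\<Sum>v\<in>UNIV. g v) = 0"
    by (simp add: g_def sum_subtractf c_def)
  ultimately have "l * (\<Sum>v\<in>UNIV. (g v)\<^sup>2) \<le> real D"
    using ray by fastforce
  with mult_left_mono[OF var l] have "l * (real D * (real D + 1) * (real D + 2) / 12) \<le> real D"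
    by linarith
  then have "real D * (l * ((real D + 1) * (real D + 2))) \<le> real D * 12"
    by (simp add: field_simps)
  then have "l * ((real D + 1) * (real D + 2)) \<le> 12"
    using False by simp
  moreover have "l * (real D)\<^sup>2 \<le> l * ((real D + 1) * (real D + 2))"
    using l by (intro mult_left_mono) (auto simp: power2_eq_square algebra_simps)
  ultimately show ?thesis by linarith
qed simp

text \<open>With \<open>m\<close> the maximum of \<bar>f\<bar> on the branch,
  \<open>l * m * \<tau>\<close> dominates both signs of \<open>f - f (p k)\<close> by the minimum
  principle, because the Laplacian of \<open>f\<close> is at most \<open>l * m\<close> in absolute
  value. This bounds the deviation by \<open>l * h * m\<close>.\<close>

lemma branch_deviation:
  assumes eig: "\<And>v. graph_laplace E f v = l * f v" and l: "0 \<le> l"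
    and \<tau>: "\<And>v. b v = k \<Longrightarrow> v \<noteq> p k \<Longrightarrow> 1 \<le> graph_laplace E \<tau> v" "\<tau> (p k) = 0"
    and h: "\<And>v. b v = k \<Longrightarrow> \<tau> v \<le> h" and lh: "l * h \<le> 1 / 2"
    and v: "b v = k" and k: "k \<le> D"
  shows "\<bar>f v - f (p k)\<bar> \<le> 2 * l * h * \<bar>f (p k)\<bar>"
proof -
  let ?a = "p k"
  define K where "K = {v. b v = k} - {?a}"
  define m where "m = Max ((\<lambda>v. \<bar>f v\<bar>) ` {v. b v = k})"
  have fm: "\<bar>f u\<bar> \<le> m" if "b u = k" for u
    using that unfolding m_def by (intro Max_ge) auto
  have m0: "0 \<le> m" using fm[OF v] by linarith
  have Knb: "w \<in> insert ?a K" if "u \<in> K" "E u w" for u w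
    using that edge[of u w] by (auto simp: K_def b_p)
  have aK: "?a \<notin> K" by (simp add: K_def)
  \<comment> \<open>The sign \<open>s\<close> treats the upper and the lower bound at once.\<close>
  have bound: "s * (f u - f ?a) \<le> l * m * \<tau> u" if s: "\<bar>s\<bar> = 1" and u: "b u = k" for s u
  proof (cases "u = ?a")
    case False
    define q where "q w = l * m * \<tau> w - s * (f w - f ?a)" for w
    have lap: "graph_laplace E q w = l * m * graph_laplace E \<tau> w - s * (l * f w)" for w
    proof -
      have "graph_laplace E q w = l * m * graph_laplace E \<tau> w - s * graph_laplace E f w"
        unfolding graph_laplace_def sum_distrib_left sum_subtractf[symmetric]
        by (intro sum.cong) (auto simp: q_def algebra_simps)
      then show ?thesis by (simp add: eig)
    qed
    have "0 \<le> q u"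
    proof (rule superharmonic_nonneg[OF conn _ aK])
      show "z \<in> insert ?a K" if "w \<in> K" "E w z" for w z
        using that by (rule Knb)
      show "0 \<le> graph_laplace E q w" if "w \<in> K" for w
      proof -
        have "s * (l * f w) \<le> l * (\<bar>s\<bar> * \<bar>f w\<bar>)"
          using l by (metis abs_ge_self abs_mult mult.left_commute mult_left_mono)
        also have "\<dots> \<le> l * m * 1"
          using s fm[of w] that l by (auto simp: K_def intro: mult_left_mono)
        also have "\<dots> \<le> l * m * graph_laplace E \<tau> w"
          using \<tau>(1)[of w] that l m0 by (intro mult_left_mono) (auto simp: K_def)
        finally show ?thesis by (simp add: lap)
      qed
      show "0 \<le> q ?a" by (simp add: q_def \<tau>(2))
      show "u \<in> K" using u False by (simp add: K_def)
    qed
    then show ?thesis by (simp add: q_def)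
  qed (simp add: \<tau>(2))
  have dev: "\<bar>f u - f ?a\<bar> \<le> l * h * m" if "b u = k" for u
  proof -
    have "l * m * \<tau> u \<le> l * m * h"
      using l m0 h[OF that] by (intro mult_left_mono) auto
    then show ?thesis
      using bound[of 1 u] bound[of "-1" u] that by (auto simp: algebra_simps)
  qed
  have "m \<in> (\<lambda>v. \<bar>f v\<bar>) ` {v. b v = k}"
    unfolding m_def using v by (intro Max_in) auto
  then obtain u where u: "b u = k" "\<bar>f u\<bar> = m" by auto
  \<comment> \<open>At a vertex attaining \<open>m\<close>, half of \<open>m\<close> absorbs the
    deviation, so \<open>m\<close> is at most twice the value at the attaching vertex.\<close>
  have "l * h * m \<le> 1 / 2 * m"
    using lh m0 by (intro mult_right_mono) auto
  with dev[OF u(1)] u(2) have m2: "m \<le> 2 * \<bar>f ?a\<bar>" by linarith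
  have "0 \<le> h" using h[of ?a] k by (simp add: \<tau>(2) b_p)
  with m2 l have "l * h * m \<le> l * h * (2 * \<bar>f ?a\<bar>)"
    by (intro mult_left_mono) auto
  with dev[OF v] show ?thesis by simp
qed

text \<open>If \<open>f\<close> vanishes at all path vertices up to \<open>k\<close>,
  \<open>near\<close> makes it vanish on their branches, and \<open>flow\<close> then carries the
  zero to the next path vertex.\<close>

lemma zero_start_imp_zero:
  assumes eig: "\<And>v. graph_laplace E f v = l * f v"
    and near: "\<And>v. \<bar>f v - f (p (b v))\<bar> \<le> \<bar>f (p (b v))\<bar> / 2"
    and start: "f (p 0) = 0"
  shows "f v = 0"
proof -
  have "\<forall>j\<le>k. f (p j) = 0" if "k \<le> D" for k
    using that
  proof (induction k)
    case (Suc k)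
    have "f v = 0" if "b v \<le> k" for v
      using near[of v] Suc that by simp
    then have "(\<Sum>v | b v \<le> k. f v) = 0" by simp
    with flow[of f l k] eig Suc have "f (p (Suc k)) = 0" by simp
    with Suc show ?case by (auto simp: le_Suc_eq)
  qed (simp add: start)
  then have "f (p (b v)) = 0" using b_le[of v] by blast
  then show ?thesis using near[of v] by simp
qed

end

text \<open>Here \<open>near\<close> gives each branch the sign of its attaching vertex,
  \<open>minimizer\<close> is the equality case of the Rayleigh bound, and \<open>start_pos\<close>
  fixes the free sign of the eigenfunction.\<close>

locale path_eigenfunction = branched_path E p b D
  for E :: "'v::finite \<Rightarrow> 'v \<Rightarrow> bool" and p :: "nat \<Rightarrow> 'v" and b :: "'v \<Rightarrow> nat" and D :: nat +
  fixes f :: "'v \<Rightarrow> real" and l :: real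
  assumes l_pos: "0 < l"
    and eig: "\<And>v. graph_laplace E f v = l * f v"
    and near: "\<And>v. \<bar>f v - f (p (b v))\<bar> \<le> \<bar>f (p (b v))\<bar> / 2"
    and minimizer: "\<And>g v. (\<Sum>v\<in>UNIV. g v) = 0 \<Longrightarrow>
      (\<Sum>v\<in>UNIV. g v * graph_laplace E g v) \<le> l * (\<Sum>v\<in>UNIV. (g v)\<^sup>2) \<Longrightarrow>
      graph_laplace E g v = l * g v"
    and start_pos: "0 < f (p 0)"
begin

lemma sum_zero: "(\<Sum>v\<in>UNIV. f v) = 0"
  using graph_laplace_sum_zero[OF sym, of f] l_pos by (simp add: eig flip: sum_distrib_left)

lemma branch_pos: "0 < f (p (b v)) \<Longrightarrow> 0 < f v"
  and branch_nonpos: "f (p (b v)) \<le> 0 \<Longrightarrow> f v \<le> 0"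
  using near[of v] by (auto simp: abs_if split: if_splits)

text \<open>
  If the sign changed twice, \<open>f\<close> restricted to the first positive stretch \<open>b v \<le> q\<close> and to the
  later positive stretches, balanced so as to have mean zero, would be a minimizer of the Rayleigh
  quotient, hence an eigenfunction; the flow through the gap between the stretches excludes this.
\<close>

lemma single_sign_change:
  assumes ij: "i < j" "j \<le> D" and fi: "f (p i) \<le> 0"
  shows "f (p j) \<le> 0"
proof (rule ccontr)
  assume fj: "\<not> f (p j) \<le> 0"
  \<comment> \<open>The first positive stretch ends at \<open>q = i0 - 1\<close>. The index
    \<open>i0\<close> itself belongs to no positive stretch and separates \<open>A\<close> from
    \<open>C\<close>.\<close>
  define i0 where "i0 = (LEAST i. f (p i) \<le> 0)"
  have i0: "f (p i0) \<le> 0" unfolding i0_def by (rule LeastI[of _ i]) (rule fi)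
  have i0i: "i0 \<le> i" unfolding i0_def by (rule Least_le) (rule fi)
  have before: "0 < f (p k)" if "k < i0" for k
    using not_less_Least that unfolding i0_def by force
  obtain q where q: "i0 = Suc q"
    using i0 start_pos by (cases i0) auto
  have qD: "Suc q < D" using i0i ij q by simp
  define A where "A = {v. b v \<le> q}"
  define C where "C = {v. q < b v \<and> 0 < f (p (b v))}"
  have fA: "0 < f v" if "v \<in> A" for v
    by (rule branch_pos) (use that before[of "b v"] in \<open>auto simp: A_def q\<close>)
  have fC: "0 < f v" if "v \<in> C" for v
    by (rule branch_pos) (use that in \<open>auto simp: C_def\<close>)
  define a where "a = (\<Sum>v\<in>A. f v)"
  define c where "c = (\<Sum>v\<in>C. f v)"
  have "p 0 \<in> A" by (simp add: A_def b_p)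
  then have a: "0 < a" unfolding a_def by (intro sum_pos fA) auto
  have "p j \<in> C" using ij i0i fj q by (simp add: C_def b_p)
  then have c: "0 < c" unfolding c_def by (intro sum_pos fC) auto
  \<comment> \<open>These weights give the two stretches the opposite totals \<open>c * a\<close>
    and \<open>- a * c\<close>.\<close>
  define w where "w v = (if v \<in> A then c else if v \<in> C then - a else 0)" for v
  define g where "g v = w v * f v" for v
  have disj: "A \<inter> C = {}" by (auto simp: A_def C_def)
  have "(\<Sum>v\<in>UNIV. g v) = (\<Sum>v\<in>UNIV. (if v \<in> A then c * f v else 0) + (if v \<in> C then - a * f v else 0))"
    using disj by (intro sum.cong) (auto simp: g_def w_def)
  also have "\<dots> = c * a - a * c"
    by (simp add: sum.distrib sum.If_cases a_def c_def sum_distrib_left[symmetric] sum_negf)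
  finally have g0: "(\<Sum>v\<in>UNIV. g v) = 0" by simp
  \<comment> \<open>Equality holds when \<open>w v = 0\<close> or \<open>w u = w v\<close>.
    Otherwise \<open>u\<close> lies outside both stretches, since no edge joins \<open>A\<close> to
    \<open>C\<close>, and \<open>f u \<le> 0\<close> gives the missing term the right sign.\<close>
  have edge_le: "g v * (g v - g u) \<le> (w v)\<^sup>2 * f v * (f v - f u)" if vu: "E v u" for u v
  proof (cases "w v = 0 \<or> w u = w v")
    case True
    then show ?thesis by (auto simp: g_def power2_eq_square algebra_simps)
  next
    case False
    have "w v = w u" if "b v = b u"
      unfolding w_def A_def C_def mem_Collect_eq that ..
    then have "b v \<noteq> b u" using False by metis
    with edge[OF vu] obtain k where k: "k < D" "(v = p k \<and> u = p (Suc k)) \<or> (v = p (Suc k) \<and> u = p k)"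
      by blast
    have vAC: "v \<in> A \<union> C" using False by (auto simp: w_def split: if_splits)
    have "u \<notin> A \<union> C"
    proof
      assume "u \<in> A \<union> C"
      with False vAC have "(v \<in> A \<and> u \<in> C) \<or> (v \<in> C \<and> u \<in> A)" by (auto simp: w_def split: if_splits)
      then have "k = q" using k by (auto simp: A_def C_def b_p)
      then show False
        using \<open>(v \<in> A \<and> u \<in> C) \<or> (v \<in> C \<and> u \<in> A)\<close> k i0 by (auto simp: A_def C_def b_p q)
    qed
    then have wu: "w u = 0" and fu: "f u \<le> 0"
      using branch_nonpos[of u] by (auto simp: w_def A_def C_def)
    have "0 \<le> (w v)\<^sup>2 * (f v * (- f u))"
      using vAC fA[of v] fC[of v] fu by (intro mult_nonneg_nonneg) auto
    then show ?thesis
      using wu by (simp add: g_def power2_eq_square algebra_simps)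
  qed
  have "(\<Sum>v\<in>UNIV. g v * graph_laplace E g v) \<le> (\<Sum>v\<in>UNIV. ((w v)\<^sup>2 * f v) * graph_laplace E f v)"
    unfolding graph_laplace_double_sum by (intro sum_mono) (simp add: edge_le)
  also have "\<dots> = l * (\<Sum>v\<in>UNIV. (g v)\<^sup>2)"
    by (auto simp: eig g_def sum_distrib_left power2_eq_square algebra_simps intro!: sum.cong)
  finally have geig: "graph_laplace E g v = l * g v" for v
    using minimizer[OF g0] by blast
  have sumA: "(\<Sum>v | b v \<le> q. f v) = a" "(\<Sum>v | b v \<le> q. g v) = c * a"
    by (auto simp: a_def A_def g_def w_def sum_distrib_left intro!: sum.cong)
  have gap: "g v = 0" if "b v = Suc q" for v
    using that i0 by (auto simp: g_def w_def A_def C_def q)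
  have "g (p q) = c * f (p q)" "g (p (Suc q)) = 0"
    using qD gap by (auto simp: g_def w_def A_def b_p)
  \<comment> \<open>Comparing the flows of \<open>g\<close> and \<open>f\<close> across the edge
    after \<open>q\<close> yields \<open>f (p (Suc q)) = 0\<close>, so the whole branch there
    vanishes. Across the next edge, \<open>f\<close> becomes negative, so \<open>g\<close> is 0
    there, whereas the flow of \<open>g\<close> demands \<open>- l * (c * a)\<close>.\<close>
  with flow[OF geig, of q] qD sumA have "c * f (p q) = c * (l * a)" by simp
  then have "f (p q) = l * a" using c by simp
  with flow[OF eig, of q] qD sumA have fgap: "f (p (Suc q)) = 0" by simp
  have fgap': "f v = 0" if "b v = Suc q" for v
    using near[of v] that fgap by simp
  have split: "(\<Sum>v | b v \<le> Suc q. h v) = (\<Sum>v | b v \<le> q. h v)"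
    if "\<And>v. b v = Suc q \<Longrightarrow> h v = 0" for h :: "'v \<Rightarrow> real"
    using that by (intro sum.mono_neutral_right) (auto simp: le_Suc_eq)
  have "f (p (Suc (Suc q))) = - l * a"
    using flow[OF eig, of "Suc q"] qD sumA split[of f] fgap fgap' by simp
  moreover have "0 < l * a" using l_pos a by simp
  ultimately have "g (p (Suc (Suc q))) = 0"
    using qD by (simp add: g_def w_def A_def C_def b_p)
  moreover have "g (p (Suc (Suc q))) = - l * (c * a)"
    using flow[OF geig, of "Suc q"] qD sumA split[of g] gap \<open>g (p (Suc q)) = 0\<close> by simp
  ultimately show False using l_pos a c by simp
qed

text \<open>With a single sign change, either all values up to \<open>k\<close> are positive or all
  values beyond \<open>k\<close> are nonpositive; in the latter case the total sum zero gives the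
  claim.\<close>

lemma flux_nonneg:
  assumes "k < D"
  shows "0 \<le> (\<Sum>v | b v \<le> k. f v)"
proof (cases "0 < f (p k)")
  case True
  have "0 < f v" if "b v \<le> k" for v
  proof (rule branch_pos)
    show "0 < f (p (b v))"
      using single_sign_change[of "b v" k] True that assms by (cases "b v = k") force+
  qed
  then show ?thesis by (intro sum_nonneg) (simp add: less_imp_le)
next
  case False
  have "f v \<le> 0" if "k < b v" for v
    by (rule branch_nonpos) (use single_sign_change[OF that b_le] False in auto)
  then have "(\<Sum>v\<in>- {v. b v \<le> k}. f v) \<le> 0" by (intro sum_nonpos) auto
  moreover have "(\<Sum>v | b v \<le> k. f v) + (\<Sum>v\<in>- {v. b v \<le> k}. f v) = 0"
    unfolding sum_zero[symmetric] by (subst sum.union_disjoint[symmetric]) (auto intro: sum.cong)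
  ultimately show ?thesis by linarith
qed

lemma path_antimono:
  assumes "i \<le> j" "j \<le> D"
  shows "f (p j) \<le> f (p i)"
  using assms
proof (induction j rule: dec_induct)
  case (step n)
  have "0 \<le> l * (\<Sum>v | b v \<le> n. f v)"
    using l_pos flux_nonneg[of n] step.prems by simp
  with flow[OF eig, of n] step show ?case by simp
qed simp

text \<open>By monotonicity the \<open>n + 1\<close> path vertices up to \<open>n\<close> have
  values at least \<open>f (p k)\<close>, and the remaining vertices there are positive. So
  \<open>f\<close> drops by at least \<open>l * (n + 1) * f (p k)\<close> across the edge after
  \<open>n\<close>; sum over \<open>n < k\<close>. Indices start at 0 here.\<close>

lemma drop_from_start:
  assumes fk: "0 < f (p k)" and k: "k \<le> D"
  shows "l * (real k * (real k + 1) / 2) * f (p k) \<le> f (p 0) - f (p k)"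
proof -
  have "l * (real n * (real n + 1) / 2) * f (p k) \<le> f (p 0) - f (p n)" if "n \<le> k" for n
    using that
  proof (induction n)
    case (Suc n)
    have "(real n + 1) * f (p k) = (\<Sum>j\<le>n. f (p k))" by simp
    also have "\<dots> \<le> (\<Sum>j\<le>n. f (p j))"
      using Suc.prems k by (intro sum_mono path_antimono) auto
    also have "\<dots> = (\<Sum>v\<in>p ` {..n}. f v)"
      using Suc.prems k by (subst sum.reindex) (auto intro!: inj_on_inverseI[of _ b] simp: b_p)
    also have "\<dots> \<le> (\<Sum>v | b v \<le> n. f v)"
    proof (rule sum_mono2)
      show "p ` {..n} \<subseteq> {v. b v \<le> n}" using Suc.prems k by (auto simp: b_p)
      show "0 \<le> f v" if "v \<in> {v. b v \<le> n} - p ` {..n}" for v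
        by (rule less_imp_le[OF branch_pos])
          (use that path_antimono[of "b v" k] Suc.prems k fk in auto)
    qed simp
    finally have "l * ((real n + 1) * f (p k)) \<le> l * (\<Sum>v | b v \<le> n. f v)"
      using l_pos by simp
    with flow[OF eig, of n] Suc k show ?case by (simp add: field_simps)
  qed simp
  then show ?thesis by simp
qed

text \<open>On branches where \<open>f\<close> is positive, the drop along the path outweighs the
  assumed deviation.\<close>

lemma max_at_start:
  assumes "\<And>v. \<bar>f v - f (p (b v))\<bar> \<le> l * (real (b v) * (real (b v) + 1) / 2) * \<bar>f (p (b v))\<bar>"
  shows "f v \<le> f (p 0)"
proof (cases "0 < f (p (b v))")
  case True
  then show ?thesis
    using assms[of v] drop_from_start[OF True b_le] abs_of_pos[OF True] by linarith
next
  case False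
  then show ?thesis using branch_nonpos[of v] start_pos by simp
qed

text \<open>A positive value at the end would make \<open>f\<close> positive everywhere, against
  mean zero; a zero there would propagate back to the start.\<close>

lemma end_neg: "f (p D) < 0"
proof -
  have "f (p D) \<le> 0"
  proof (rule ccontr)
    assume neg: "\<not> f (p D) \<le> 0"
    have "0 < f v" for v
      by (rule branch_pos) (use path_antimono[OF b_le order_refl, of v] neg in auto)
    then have "0 < (\<Sum>v\<in>UNIV. f v)" by (intro sum_pos) auto
    then show False using sum_zero by simp
  qed
  moreover have "f (p D) \<noteq> 0"
  proof
    assume "f (p D) = 0"
    moreover have "f (p 0) = 0" if "f (p (D - 0)) = 0"
      using eig _ that by (rule branched_path.zero_start_imp_zero[OF reversed])
        (simp only: near b_le diff_diff_cancel)
    ultimately have "f (p 0) = 0" by simp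
    then show False using start_pos by simp
  qed
  ultimately show ?thesis by simp
qed

text \<open>Negating \<open>f\<close> and reversing the path preserves all assumptions, with
  \<open>end_neg\<close> providing the positive start. The minimum at the end thereby reduces to the
  maximum at the start.\<close>

lemma reversed_eigenfunction:
  "path_eigenfunction E (\<lambda>k. p (D - k)) (\<lambda>v. D - b v) D (\<lambda>v. - f v) l"
proof (rule path_eigenfunction.intro[OF reversed], unfold_locales)
  show "\<bar>- f v - - f (p (D - (D - b v)))\<bar> \<le> \<bar>- f (p (D - (D - b v)))\<bar> / 2" for v
    using near[of v] b_le[of v] by (simp add: abs_minus_commute)
  show "0 < - f (p (D - 0))" using end_neg by simp
  show "graph_laplace E g v = l * g v" if "(\<Sum>v\<in>UNIV. g v) = 0"
    "(\<Sum>v\<in>UNIV. g v * graph_laplace E g v) \<le> l * (\<Sum>v\<in>UNIV. (g v)\<^sup>2)" for g v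
    using that by (rule minimizer)
qed (simp_all add: l_pos graph_laplace_uminus eig)

lemma min_at_end:
  assumes "\<And>v. \<bar>f v - f (p (b v))\<bar> \<le>
    l * ((real D - real (b v)) * (real D - real (b v) + 1) / 2) * \<bar>f (p (b v))\<bar>"
  shows "f (p D) \<le> f v"
proof -
  interpret rev: path_eigenfunction E "\<lambda>k. p (D - k)" "\<lambda>v. D - b v" D "\<lambda>v. - f v" l
    by (rule reversed_eigenfunction)
  have "- f v \<le> - f (p (D - 0))"
    using assms b_le by (intro rev.max_at_start) (simp add: of_nat_diff abs_minus_commute)
  then show ?thesis by simp
qed

end


section \<open>From attached graphs to branches of the path\<close>

lemma connected_graph_neighbors:
  assumes "connected_graph E" "u \<noteq> v"
  shows "neighbors E v \<noteq> {}"
proof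
  assume "neighbors E v = {}"
  then have "{v} = UNIV"
    using assms(1) by (intro connected_graph_closed_UNIV[of E v]) (auto simp: neighbors_def)
  then show False using assms(2) by auto
qed

text \<open>Disjointness of the attached graphs makes the attaching index \<open>b\<close> well
  defined, and it changes only across path edges. \<open>Suc\<close> converts the index
  \<open>b v\<close>, counted from 0, to the numbering of the path from 1.\<close>

lemma branched_path_of_attachments:
  assumes E: "symp E" "connected_graph E"
    and P: "is_path E P" "length P = Suc D"
    and att: "path_with_attachments E P m H"
  shows "\<exists>b. branched_path E ((!) P) b D \<and>
    (\<forall>v. v \<notin> set P \<longrightarrow> (\<exists>i. (Suc (b v), i) \<in> attachment_indices P m \<and> v \<in> H (Suc (b v)) i))"
proof -
  let ?I = "attachment_indices P m"
  have dist: "distinct P" and succ: "successively E P"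
    using P by (auto simp: is_path_def is_walk_def)
  have disjP: "v \<notin> set P" if "(k, i) \<in> ?I" "v \<in> H k i" for k i v
    using att that by (auto simp: path_with_attachments_def)
  have disjH: "k = k'" if "(k, i) \<in> ?I" "v \<in> H k i" "(k', i') \<in> ?I" "v \<in> H k' i'" for k i k' i' v
  proof (rule ccontr)
    assume "k \<noteq> k'"
    moreover have "disjoint_family_on (\<lambda>(k, i). H k i) ?I"
      using att by (simp add: path_with_attachments_def)
    ultimately have "H k i \<inter> H k' i' = {}"
      using disjoint_family_onD[of "\<lambda>(k, i). H k i" ?I "(k, i)" "(k', i')"] that by simp
    with that show False by blast
  qed
  have cover: "\<exists>k i. (k, i) \<in> ?I \<and> v \<in> H k i" if "v \<notin> set P" for v
  proof -
    have "UNIV = set P \<union> (\<Union>(k, i) \<in> ?I. H k i)"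
      using att unfolding path_with_attachments_def by (elim conjE)
    then have "v \<in> set P \<union> (\<Union>(k, i) \<in> ?I. H k i)" by (rule eqset_imp_iff[THEN iffD1]) simp
    with that show ?thesis by auto
  qed
  have idx: "\<exists>j. k = Suc j \<and> j \<le> D" if "(k, i) \<in> ?I" for k i
    using that P(2) by (cases k) (auto simp: attachment_indices_def)
  define b where "b v = (if v \<in> set P then THE k. k < length P \<and> P ! k = v
      else SOME k. \<exists>i. (Suc k, i) \<in> ?I \<and> v \<in> H (Suc k) i)" for v
  have bP: "b (P ! k) = k" if "k \<le> D" for k
    using that P(2) dist by (auto simp: b_def nth_eq_iff_index_eq intro!: the_equality)
  have bex: "\<exists>i. (Suc (b v), i) \<in> ?I \<and> v \<in> H (Suc (b v)) i" if "v \<notin> set P" for v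
  proof -
    have "\<exists>k i. (Suc k, i) \<in> ?I \<and> v \<in> H (Suc k) i"
      using cover[OF that] idx by blast
    then have "\<exists>i. (Suc (SOME k. \<exists>i. (Suc k, i) \<in> ?I \<and> v \<in> H (Suc k) i), i) \<in> ?I \<and>
        v \<in> H (Suc (SOME k. \<exists>i. (Suc k, i) \<in> ?I \<and> v \<in> H (Suc k) i)) i"
      by (rule someI_ex)
    then show ?thesis using that by (simp add: b_def)
  qed
  have bH: "Suc (b v) = k" if "(k, i) \<in> ?I" "v \<in> H k i" for k i v
    using bex[OF disjP[OF that]] disjH that by blast
  have "branched_path E ((!) P) b D"
  proof
    show "b (P ! k) = k" if "k \<le> D" for k using that by (rule bP)
    show "b v \<le> D" for v
    proof (cases "v \<in> set P")
      case True
      then show ?thesis using bP P(2) by (metis in_set_conv_nth less_Suc_eq_le)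
    next
      case False
      then show ?thesis using bex idx by blast
    qed
    show "E (P ! k) (P ! Suc k)" if "k < D" for k
      using succ that P(2) by (simp add: successively_conv_nth)
    show "b u = b v \<or> (\<exists>k<D. (u = P ! k \<and> v = P ! Suc k) \<or> (u = P ! Suc k \<and> v = P ! k))"
      if "E u v" for u v
    proof -
      have "(\<exists>k. 1 \<le> k \<and> k < length P \<and> {u, v} = {path_vertex P k, path_vertex P (k + 1)}) \<or>
          (\<exists>(k, i) \<in> ?I. {u, v} \<subseteq> insert (path_vertex P k) (H k i))"
        using att[unfolded path_with_attachments_def, THEN conjunct2, THEN conjunct2, THEN conjunct2] that
        by (elim allE impE) assumption+
      then show ?thesis
      proof (elim disjE exE conjE bexE)
        fix k assume k: "1 \<le> k" "k < length P" "{u, v} = {path_vertex P k, path_vertex P (k + 1)}"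
        then show ?thesis
          using P(2) by (intro disjI2 exI[of _ "k - 1"]) (auto simp: path_vertex_def doubleton_eq_iff)
      next
        fix z assume "z \<in> ?I" "case z of (k, i) \<Rightarrow> {u, v} \<subseteq> insert (path_vertex P k) (H k i)"
        then obtain k i where k: "(k, i) \<in> ?I" "{u, v} \<subseteq> insert (path_vertex P k) (H k i)"
          by (cases z) auto
        obtain j where "k = Suc j" "j \<le> D" using idx[OF k(1)] by blast
        then have "Suc (b x) = k" if "x \<in> {u, v}" for x
          using that k bH[OF k(1)] bP by (auto simp: path_vertex_def)
        from this[of u] this[of v] show ?thesis by simp
      qed
    qed
  qed (use E in auto)
  then show ?thesis using bex by auto
qed

theorem theorem2:
  fixes E :: "'v::finite \<Rightarrow> 'v \<Rightarrow> bool"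
    and \<phi> :: "real^'v"
    and P :: "'v list"
    and m :: "nat \<Rightarrow> nat"
    and H :: "nat \<Rightarrow> nat \<Rightarrow> 'v set"
  assumes "simple_graph E"
    and "connected_graph E"
    and "is_eigenvector (laplacian E) (lambda2 E) \<phi>"
    and "diametral_path E P"
    and "path_with_attachments E P m H"
    and "isolated_attachments E P m H"
    and "\<And>k i. (k, i) \<in> attachment_indices P m \<Longrightarrow>
           real (card (H k i)) \<le> real (graph_diam E) / 32"
    and "\<And>k i. (k, i) \<in> attachment_indices P m \<Longrightarrow>
           hit_max E (set P) (H k i) \<le>
             ennreal (1 / 50 * (min (real k) (real (graph_diam E) - real k))\<^sup>2)"
  shows "(\<phi> $ hd P = Max (range (($) \<phi>)) \<and> \<phi> $ last P = Min (range (($) \<phi>))) \<or>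
         (\<phi> $ hd P = Min (range (($) \<phi>)) \<and> \<phi> $ last P = Max (range (($) \<phi>)))"
proof -
  define D where "D = graph_diam E"
  define l where "l = lambda2 E"
  define f where "f = ($) \<phi>"
  have sym: "symp E" using assms(1) by (simp add: simple_graph_def)
  have path: "is_path E P" and "walk_length P = D"
    using assms(4) by (simp_all add: diametral_path_def D_def)
  then have len: "length P = Suc D"
    by (cases P) (auto simp: is_path_def is_walk_def walk_length_def)
  obtain b where bp: "branched_path E ((!) P) b D" and bex: "\<And>v. v \<notin> set P \<Longrightarrow>
      \<exists>i. (Suc (b v), i) \<in> attachment_indices P m \<and> v \<in> H (Suc (b v)) i"
    using branched_path_of_attachments[OF sym assms(2) path len assms(5)] by auto
  interpret branched_path E "(!) P" b D by (rule bp)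
  have "P \<noteq> []" using len by auto
  then have ends: "hd P = P ! 0" "last P = P ! D"
    using len by (simp_all add: hd_conv_nth last_conv_nth)
  have eig: "graph_laplace E f v = l * f v" for v
    using assms(3) laplacian_mult_vec[of E \<phi> v]
    by (simp add: is_eigenvector_def eigenspace_def f_def l_def)
  have nz: "\<exists>v. f v \<noteq> 0"
    using assms(3) by (auto simp: is_eigenvector_def f_def vec_eq_iff)
  have l0: "0 \<le> l"
  proof -
    have "0 \<le> l * (\<Sum>v\<in>UNIV. (f v)\<^sup>2)"
      using graph_laplace_energy_nonneg[OF sym, of f]
      by (simp add: eig sum_distrib_left power2_eq_square algebra_simps)
    moreover have "0 < (\<Sum>v\<in>UNIV. (f v)\<^sup>2)"
      using nz by (auto intro!: sum_pos2)
    ultimately show ?thesis by (simp add: zero_le_mult_iff)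
  qed
  have lD: "l * (real D)\<^sup>2 \<le> 12"
    unfolding l_def by (rule rayleigh_bound[OF lambda2_rayleigh(1)[OF sym assms(2)]])
      (use l0 in \<open>simp_all add: l_def\<close>)
  \<comment> \<open>The hypothesis on hitting times at the vertex with index \<open>k\<close>, whose
    number on the path is \<open>Suc k\<close>.\<close>
  define h where "h k = 1 / 50 * (min (real (Suc k)) (real D - real (Suc k)))\<^sup>2" for k
  define \<tau> where "\<tau> v = enn2real (hit E (set P) v)" for v
  have hit_le: "hit E (set P) v \<le> ennreal (h (b v))" for v
  proof (cases "v \<in> set P")
    case True
    then show ?thesis by (simp add: hit_mem)
  next
    case False
    then obtain i where i: "(Suc (b v), i) \<in> attachment_indices P m" "v \<in> H (Suc (b v)) i"
      using bex by blast
    have "hit E (set P) v \<le> hit_max E (set P) (H (Suc (b v)) i)"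
      unfolding hit_max_def using i(2) by (intro Max_ge) auto
    also have "\<dots> \<le> ennreal (h (b v))"
      using assms(8)[OF i(1)] by (simp only: h_def D_def)
    finally show ?thesis .
  qed
  have h0: "0 \<le> h k" for k by (simp add: h_def)
  have \<tau>_le: "\<tau> v \<le> h (b v)" for v
    unfolding \<tau>_def by (rule enn2real_leI[OF h0 hit_le])
  have offP: "v \<notin> set P" if "v \<noteq> P ! b v" for v
    using that b_p len by (metis in_set_conv_nth less_Suc_eq_le)
  have nb: "neighbors E v \<noteq> {}" if "v \<notin> set P" for v
    by (rule connected_graph_neighbors[OF assms(2), of "P ! 0"]) (use that len in auto)
  have \<tau>_lap: "1 \<le> graph_laplace E \<tau> v" if "v \<noteq> P ! b v" for v
  proof -
    have "graph_laplace E \<tau> v = real (card (neighbors E v))"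
      unfolding \<tau>_def
      by (intro graph_laplace_hit offP that nb le_less_trans[OF hit_le]) simp
    moreover have "0 < card (neighbors E v)"
      using nb[OF offP[OF that]] by (simp add: card_gt_0_iff)
    ultimately show ?thesis by simp
  qed
  \<comment> \<open>The first bound makes \<open>l * h\<close> small; the other two compare the
    deviation with the change of the eigenfunction towards either end.\<close>
  have h_bounds: "h (b v) \<le> (real D)\<^sup>2 / 200"
      "2 * h (b v) \<le> real (b v) * (real (b v) + 1) / 2"
      "2 * h (b v) \<le> (real D - real (b v)) * (real D - real (b v) + 1) / 2"
    if v: "v \<noteq> P ! b v" for v
  proof -
    define x y where "x = real (b v) + 1" and "y = real D - real (b v) - 1"
    define z where "z = min x y"
    have hz: "h (b v) = z\<^sup>2 / 50" by (simp add: h_def z_def x_def y_def add.commute diff_diff_eq)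
    \<comment> \<open>A hitting time of at least 1 forces \<open>z\<^sup>2 \<ge> 50\<close>. This
      also rules out the last path vertex, where \<open>y = -1\<close> would have a positive
      square.\<close>
    have "1 \<le> ennreal (h (b v))"
      using hit_ge_1[OF offP[OF v] nb[OF offP[OF v]]] hit_le by (rule order_trans)
    then have z50: "50 \<le> z\<^sup>2" using hz by simp
    have "-1 \<le> z" using b_le[of v] by (simp add: z_def x_def y_def)
    have z2: "2 \<le> z"
    proof (rule ccontr)
      assume "\<not> 2 \<le> z"
      with \<open>-1 \<le> z\<close> have "\<bar>z\<bar> \<le> \<bar>2\<bar>" by linarith
      then have "z\<^sup>2 \<le> 2\<^sup>2" by (rule abs_le_square_iff[THEN iffD1])
      with z50 show False by simp
    qed
    have zx: "z \<le> x" and zy: "z \<le> y" by (simp_all add: z_def)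
    have "z \<le> real D / 2" using zx zy by (simp add: x_def y_def)
    then have "z\<^sup>2 \<le> (real D / 2)\<^sup>2" using z2 by (intro power_mono) auto
    then show "h (b v) \<le> (real D)\<^sup>2 / 200" by (simp add: hz power_divide)
    have "0 \<le> z * (z - 2)" using z2 by simp
    then have "2 * z \<le> z\<^sup>2" by (simp add: power2_eq_square algebra_simps)
    moreover have "z * (z - 1) = z\<^sup>2 - z" by (simp add: power2_eq_square algebra_simps)
    \<comment> \<open>From \<open>2 * z \<le> z\<^sup>2\<close> the right side is at least
      \<open>z\<^sup>2 / 4\<close>, and the left side is \<open>z\<^sup>2 / 25\<close>.\<close>
    ultimately have "2 * h (b v) \<le> z * (z - 1) / 2"
      unfolding hz using zero_le_power2[of z] by linarith
    moreover have "z * (z - 1) \<le> x * (x - 1)" using zx z2 by (intro mult_mono) auto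
    moreover have "z * (z - 1) \<le> (y + 1) * (y + 2)" using zy z2 by (intro mult_mono) auto
    ultimately show "2 * h (b v) \<le> real (b v) * (real (b v) + 1) / 2"
      "2 * h (b v) \<le> (real D - real (b v)) * (real D - real (b v) + 1) / 2"
      by (auto simp: x_def y_def algebra_simps)
  qed
  \<comment> \<open>\<open>C\<close> will be 1/2 for \<open>near\<close> and the two quadratic drops
    for the extrema. At path vertices the deviation is 0, so \<open>C\<close> is compared with
    \<open>h\<close> only off the path.\<close>
  have dev: "\<bar>g v - g (P ! b v)\<bar> \<le> C * \<bar>g (P ! b v)\<bar>"
    if g: "\<And>v. graph_laplace E g v = l * g v" and "0 \<le> C"
      and C: "v \<noteq> P ! b v \<Longrightarrow> l * (2 * h (b v)) \<le> C" for g v C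
  proof (cases "v = P ! b v")
    case True
    then have "g v = g (P ! b v)" by metis
    then show ?thesis using \<open>0 \<le> C\<close> by simp
  next
    case False
    have "l * h (b v) \<le> l * ((real D)\<^sup>2 / 200)"
      using h_bounds(1)[OF False] l0 by (rule mult_left_mono)
    then have lh: "l * h (b v) \<le> 1 / 2" using lD by simp
    have "\<bar>g v - g (P ! b v)\<bar> \<le> 2 * l * h (b v) * \<bar>g (P ! b v)\<bar>"
    proof (rule branch_deviation[OF g l0 _ _ _ lh refl b_le])
      show "1 \<le> graph_laplace E \<tau> u" if "b u = b v" "u \<noteq> P ! b v" for u
        using \<tau>_lap[of u] that by simp
      show "\<tau> (P ! b v) = 0"
        using b_le[of v] len by (simp add: \<tau>_def hit_mem)
      show "\<tau> u \<le> h (b v)" if "b u = b v" for u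
        using \<tau>_le[of u] that by simp
    qed
    also have "\<dots> \<le> C * \<bar>g (P ! b v)\<bar>"
      using C[OF False] by (intro mult_right_mono) (auto simp: mult_ac)
    finally show ?thesis .
  qed
  have near: "\<bar>g v - g (P ! b v)\<bar> \<le> \<bar>g (P ! b v)\<bar> / 2"
    if g: "\<And>v. graph_laplace E g v = l * g v" for g v
  proof -
    have "l * (2 * h (b v)) \<le> 1 / 2" if "v \<noteq> P ! b v"
      using mult_left_mono[OF h_bounds(1)[OF that] l0] lD by simp
    then show ?thesis using dev[OF g, of "1 / 2" v] by simp
  qed
  \<comment> \<open>Stated for a general \<open>g\<close>, to be applied to \<open>f\<close> or to
    its negative according to the sign at the start.\<close>
  have extrema: "g (P ! D) \<le> g v \<and> g v \<le> g (P ! 0)"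
    if g: "\<And>v. graph_laplace E g v = l * g v" and start: "0 < g (P ! 0)" and l: "0 < l" for g v
  proof -
    interpret path_eigenfunction E "(!) P" b D g l
    proof unfold_locales
      show "graph_laplace E g' v = l * g' v" if "(\<Sum>v\<in>UNIV. g' v) = 0"
        "(\<Sum>v\<in>UNIV. g' v * graph_laplace E g' v) \<le> l * (\<Sum>v\<in>UNIV. (g' v)\<^sup>2)" for g' v
        using lambda2_rayleigh(2)[OF sym assms(2) that(1)] that(2) by (simp add: l_def)
    qed (use l g start near[OF g] in auto)
    have "g v \<le> g (P ! 0)"
      by (intro max_at_start dev[OF g] mult_left_mono[OF h_bounds(2) l0]) (use l0 in simp_all)
    moreover have "g (P ! D) \<le> g v"
      by (intro min_at_end dev[OF g] mult_left_mono[OF h_bounds(3) l0]) (use l0 b_le in simp_all)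
    ultimately show ?thesis by simp
  qed
  have MaxMin: "\<phi> $ x = Max (range (($) \<phi>)) \<longleftrightarrow> (\<forall>v. f v \<le> f x)"
    "\<phi> $ x = Min (range (($) \<phi>)) \<longleftrightarrow> (\<forall>v. f x \<le> f v)" for x
    unfolding f_def by (subst eq_commute, subst Max_eq_iff, auto)
      (subst eq_commute, subst Min_eq_iff, auto)
  show ?thesis
  proof (cases "l = 0")
    \<comment> \<open>The eigenfunction is constant. A graph with one vertex falls under this case:
      its eigenvalue list has no entry 1, but the eigenvector equation still forces
      \<open>l = 0\<close>.\<close>
    case True
    then have "f u = f v" for u v
      using eig by (intro harmonic_constant[OF sym assms(2)]) simp
    then show ?thesis unfolding MaxMin by (metis order_refl)
  next
    case False
    then have l: "0 < l" using l0 by simp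
    have "f (P ! 0) \<noteq> 0"
      using zero_start_imp_zero[OF eig near[OF eig]] nz by blast
    then consider "0 < f (P ! 0)" | "0 < - f (P ! 0)" by linarith
    then show ?thesis
    proof cases
      case 1
      from extrema[OF eig this l] show ?thesis unfolding MaxMin ends by blast
    next
      case 2
      have "graph_laplace E (\<lambda>v. - f v) v = l * (- f v)" for v
        by (simp add: graph_laplace_uminus eig)
      from extrema[OF this 2 l] show ?thesis unfolding MaxMin ends by auto
    qed
  qed
qed

end
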